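(* There exists an infinite binary sequence $\gamma = \gamma_1\gamma_2\gamma_3\dots$ that is not computably random, such that its sequence of odd bits $\gamma_1\gamma_3\gamma_5\dots$ is computably random, and its sequence of even bits $\gamma_2\gamma_4\gamma_6\dots$ is computably random relative to $\gamma_1\gamma_3\gamma_5\dots$.
   Context: A martingale is a function $f$ from finite binary strings to the non-negative reals such that $f(x) = (f(x0)+f(x1))/2$ for every string $x$. An infinite binary sequence $\alpha$ is computably random (CR) if for every computable martingale $f$ the set $\{f(x) : x \text{ a finite prefix of } \alpha\}$ is bounded. It is computably random relative to a sequence $\beta$ if the same holds for every martingale that is computable with oracle $\beta$. *)

theory Defs
  imports "HOL-Analysis.Analysis" "HOL-Library.Nat_Bijection"
begin

text \<open>
  Partial recursive functions relative to an infinite binary sequence, presented as unary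
  functions on the natural numbers; tuples are passed through the Cantor pairing function
  \<^const>\<open>prod_encode\<close>.
\<close>

datatype prog =
    Zero | Succ | Left | Right | Query
  | Pair prog prog
  | Comp prog prog
  | PrimRec prog prog
  | Minimize prog

text \<open>
  \<open>computes B p x y\<close>: program \<open>p\<close>, with access to the sequence \<open>B\<close>, halts on input \<open>x\<close> with
  output \<open>y\<close>.  Minimization is that of partial recursive functions: all values before the
  first zero must be defined.
\<close>

inductive computes :: "(nat \<Rightarrow> bool) \<Rightarrow> prog \<Rightarrow> nat \<Rightarrow> nat \<Rightarrow> bool"
  for B :: "nat \<Rightarrow> bool" where
  zero: "computes B Zero x 0"
| succ: "computes B Succ x (Suc x)"
| left: "computes B Left (prod_encode (x, y)) x"
| right: "computes B Right (prod_encode (x, y)) y"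
| query: "computes B Query x (of_bool (B x))"
| pair: "computes B p x y \<Longrightarrow> computes B q x z \<Longrightarrow> computes B (Pair p q) x (prod_encode (y, z))"
| comp: "computes B q x y \<Longrightarrow> computes B p y z \<Longrightarrow> computes B (Comp p q) x z"
| prim_rec_0: "computes B p x y \<Longrightarrow> computes B (PrimRec p q) (prod_encode (x, 0)) y"
| prim_rec_Suc: "computes B (PrimRec p q) (prod_encode (x, n)) y \<Longrightarrow>
    computes B q (prod_encode (x, prod_encode (n, y))) z \<Longrightarrow>
    computes B (PrimRec p q) (prod_encode (x, Suc n)) z"
| minimize: "computes B p (prod_encode (x, n)) 0 \<Longrightarrow>
    (\<forall>i<n. \<exists>y. y \<noteq> 0 \<and> computes B p (prod_encode (x, i)) y) \<Longrightarrow>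
    computes B (Minimize p) x n"

definition computable_in :: "(nat \<Rightarrow> bool) \<Rightarrow> (nat \<Rightarrow> nat) \<Rightarrow> bool" where
  "computable_in B g \<longleftrightarrow> (\<exists>p. \<forall>x. computes B p x (g x))"

definition string_encode :: "bool list \<Rightarrow> nat" where
  "string_encode w = list_encode (map of_bool w)"

text \<open>
  A real-valued function on strings is computable if a program, given a string \<open>w\<close> and a
  precision \<open>n\<close>, produces a dyadic rational within \<open>2\<close> to the power \<open>-n\<close> of the value at \<open>w\<close>.
\<close>

definition real_computable_in :: "(nat \<Rightarrow> bool) \<Rightarrow> (bool list \<Rightarrow> real) \<Rightarrow> bool" where
  "real_computable_in B f \<longleftrightarrow>
    (\<exists>g. computable_in B g \<and>
      (\<forall>w n. \<bar>f w - of_int (int_decode (g (prod_encode (string_encode w, n)))) / 2 ^ n\<bar>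
               \<le> 1 / 2 ^ n))"

definition martingale :: "(bool list \<Rightarrow> real) \<Rightarrow> bool" where
  "martingale f \<longleftrightarrow>
    (\<forall>w. f w \<ge> 0) \<and> (\<forall>w. f w = (f (w @ [False]) + f (w @ [True])) / 2)"

definition prefix_of_seq :: "(nat \<Rightarrow> bool) \<Rightarrow> nat \<Rightarrow> bool list" where
  "prefix_of_seq A n = map A [0..<n]"

definition computably_random_rel :: "(nat \<Rightarrow> bool) \<Rightarrow> (nat \<Rightarrow> bool) \<Rightarrow> bool" where
  "computably_random_rel B A \<longleftrightarrow>
    (\<forall>f. martingale f \<and> real_computable_in B f \<longrightarrow> bounded {f (prefix_of_seq A n) |n. True})"

text \<open>
  Computability without an external sequence is computability relative to the constantly
  false one, for which \<^const>\<open>Query\<close> and \<^const>\<open>Zero\<close> compute the same function.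
\<close>

definition computably_random :: "(nat \<Rightarrow> bool) \<Rightarrow> bool" where
  "computably_random A \<longleftrightarrow> computably_random_rel (\<lambda>_. False) A"

text \<open>
  Sequences are indexed from \<open>0\<close>, so the bits at the odd positions 1, 3, 5, ... of a sequence
  indexed from \<open>1\<close> are those at the even indices 0, 2, 4, ... here.
\<close>

definition odd_bits :: "(nat \<Rightarrow> bool) \<Rightarrow> nat \<Rightarrow> bool" where
  "odd_bits C i = C (2 * i)"

definition even_bits :: "(nat \<Rightarrow> bool) \<Rightarrow> nat \<Rightarrow> bool" where
  "even_bits C i = C (2 * i + 1)"

end

theory Submission
  imports Defs
begin

text \<open>
  Fix any computably random \<open>A\<close>; we build \<open>B\<close>, computably random relative to \<open>A\<close>, such that a computable
  martingale betting on the bits of \<open>A\<close> succeeds on the join of \<open>A\<close> and \<open>B\<close>.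

  A program \<open>p\<close> with oracle \<open>A\<close> can split every string \<open>s\<close> into three incomparable extensions
  \<open>u\<close>, \<open>v0\<close>, \<open>v1\<close> along which a given \<open>A\<close>-computable martingale rises by at most \<open>2\<close> to the power
  \<open>-|s|\<close>. The sequence \<open>B\<close> passes through such extensions and uses the choice among them to send messages to
  a decoder that knows \<open>p\<close>. The decoder has to compute the three extensions, and it learns the
  oracle \<open>A\<close> bit by bit, so it finishes at some time \<open>r\<close>; this \<open>r\<close> does not depend on the
  choice made by \<open>B\<close>. Hence \<open>B\<close> can choose \<open>v0\<close> or \<open>v1\<close> according to the bit \<open>A r\<close>, and the
  decoder doubles its capital by betting on that bit. No \<open>A\<close>-computable martingale can profit from
  this, provided that it takes part in the splitting. To add one more of them, \<open>B\<close> first announces the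
  code \<open>q\<close> of a new splitting program in unary, by choosing \<open>u\<close> exactly \<open>q\<close> times.

  The new martingale must enter with a weight that is small compared with its growth on the part of \<open>B\<close>
  built so far. That part includes the announcement of \<open>q\<close>, so the weight cannot be a constant
  of the program with code \<open>q\<close>: instead it is \<open>2\<close> to the power \<open>-d\<close> where \<open>d\<close> is an input that the
  decoder supplies, namely the code of the string at which the announcement ended.

  In order to be total, the decoder does not run programs: at time \<open>r\<close> it checks whether the number \<open>r\<close>
  is the code of a derivation certificate for the computation that it waits for.
\<close>

section \<open>Closure properties of the computable functions\<close>

definition pr :: "nat \<Rightarrow> nat \<Rightarrow> nat" where "pr x y = prod_encode (x, y)"
definition pi1 :: "nat \<Rightarrow> nat" where "pi1 n = fst (prod_decode n)"
definition pi2 :: "nat \<Rightarrow> nat" where "pi2 n = snd (prod_decode n)"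

lemma pi_pr [simp]: "pi1 (pr x y) = x" "pi2 (pr x y) = y" "pr (pi1 n) (pi2 n) = n"
  by (simp_all add: pr_def pi1_def pi2_def)

lemma pi1_le: "pi1 n \<le> n" and pi2_le: "pi2 n \<le> n"
  by (metis le_prod_encode_1 pi_pr(3) pr_def, metis le_prod_encode_2 pi_pr(3) pr_def)

lemma computes_pr_intros:
  "computes B Left (pr x y) x"
  "computes B Right (pr x y) y"
  "computes B p x y \<Longrightarrow> computes B q x z \<Longrightarrow> computes B (Pair p q) x (pr y z)"
  "computes B p x y \<Longrightarrow> computes B (PrimRec p q) (pr x 0) y"
  "computes B (PrimRec p q) (pr x n) y \<Longrightarrow> computes B q (pr x (pr n y)) z \<Longrightarrow>
    computes B (PrimRec p q) (pr x (Suc n)) z"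
  "computes B p (pr x n) 0 \<Longrightarrow> (\<And>i. i < n \<Longrightarrow> \<exists>y. y \<noteq> 0 \<and> computes B p (pr x i) y) \<Longrightarrow>
    computes B (Minimize p) x n"
  unfolding pr_def by (blast intro: computes.intros)+

lemma computes_pi: "computes B Left n (pi1 n)" "computes B Right n (pi2 n)"
  using computes_pr_intros(1,2)[of B "pi1 n" "pi2 n"] by simp_all

text \<open>Closure rules that follow the syntax, so that an explicit expression is shown computable
  or decidable by applying them backwards.\<close>

named_theorems cmp

lemma cmp_compose:
  assumes "computable_in B f" "computable_in B g"
  shows "computable_in B (\<lambda>x. f (g x))"
  using assms unfolding computable_in_def by (meson computes.comp)

lemma cmp_id [cmp]: "computable_in B (\<lambda>x. x)"
proof -
  have "computes B (Pair Left Right) x x" for x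
    using computes_pr_intros(3)[OF computes_pi] by simp
  then show ?thesis unfolding computable_in_def by blast
qed

lemma cmp_Suc [cmp]: "computable_in B f \<Longrightarrow> computable_in B (\<lambda>x. Suc (f x))"
  by (rule cmp_compose) (auto simp: computable_in_def intro: computes.succ)

lemma cmp_const [cmp]: "computable_in B (\<lambda>x. c)"
proof (induction c)
  case 0
  show ?case unfolding computable_in_def by (blast intro: computes.zero)
qed (rule cmp_Suc)

lemma cmp_pr [cmp]: "computable_in B f \<Longrightarrow> computable_in B g \<Longrightarrow> computable_in B (\<lambda>x. pr (f x) (g x))"
  unfolding computable_in_def by (meson computes_pr_intros(3))

lemma cmp_pi1 [cmp]: "computable_in B f \<Longrightarrow> computable_in B (\<lambda>x. pi1 (f x))"
  by (rule cmp_compose) (auto simp: computable_in_def intro: computes_pi)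

lemma cmp_pi2 [cmp]: "computable_in B f \<Longrightarrow> computable_in B (\<lambda>x. pi2 (f x))"
  by (rule cmp_compose) (auto simp: computable_in_def intro: computes_pi)

lemma cmp_rec [cmp]:
  assumes f: "computable_in B f"
    and h: "computable_in B (\<lambda>z. h (pi1 z) (pi1 (pi2 z)) (pi2 (pi2 z)))"
    and k: "computable_in B k"
  shows "computable_in B (\<lambda>x. rec_nat (f x) (\<lambda>n y. h x n y) (k x))"
proof -
  obtain p where p: "\<And>x. computes B p x (f x)" using f by (auto simp: computable_in_def)
  obtain q where q: "\<And>z. computes B q z (h (pi1 z) (pi1 (pi2 z)) (pi2 (pi2 z)))"
    using h by (auto simp: computable_in_def)
  have q': "computes B q (pr x (pr n y)) (h x n y)" for x n y
    using q[of "pr x (pr n y)"] by simp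
  have "computes B (PrimRec p q) (pr x n) (rec_nat (f x) (h x) n)" for x n
    by (induction n) (auto intro: computes_pr_intros(4,5) p q')
  then have "computes B (PrimRec p q) z (rec_nat (f (pi1 z)) (h (pi1 z)) (pi2 z))" for z
    by (metis pi_pr(3))
  then have "computable_in B (\<lambda>z. rec_nat (f (pi1 z)) (h (pi1 z)) (pi2 z))"
    unfolding computable_in_def by blast
  from cmp_compose[OF this cmp_pr[OF cmp_id k]] show ?thesis by simp
qed

section \<open>Decidable predicates, arithmetic and unbounded search\<close>

definition decidable_in :: "(nat \<Rightarrow> bool) \<Rightarrow> (nat \<Rightarrow> bool) \<Rightarrow> bool" where
  "decidable_in B P \<longleftrightarrow> computable_in B (\<lambda>x. of_bool (P x))"

lemma cmp_if [cmp]: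
  assumes "decidable_in B P" "computable_in B f" "computable_in B g"
  shows "computable_in B (\<lambda>x. if P x then f x else g x)"
proof -
  \<comment> \<open>A case distinction is a recursion of length 0 or 1 that ignores the previous
    value.\<close>
  have "(\<lambda>x. if P x then f x else g x) = (\<lambda>x. rec_nat (g x) (\<lambda>_ _. f x) (of_bool (P x)))"
    by auto
  moreover have "computable_in B (\<lambda>x. rec_nat (g x) (\<lambda>_ _. f x) (of_bool (P x)))"
    by (rule cmp_rec[OF assms(3) cmp_compose[OF assms(2) cmp_pi1[OF cmp_id]]])
       (use assms(1) in \<open>simp add: decidable_in_def\<close>)
  ultimately show ?thesis by simp
qed

lemma dec_pos [cmp]:
  assumes "computable_in B f" shows "decidable_in B (\<lambda>x. 0 < f x)"
proof -
  have eq: "(of_bool (0 < n) :: nat) = rec_nat 0 (\<lambda>_ _. 1) n" for n by (cases n) auto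
  show ?thesis unfolding decidable_in_def eq by (intro cmp assms)
qed

lemma dec_not [cmp]:
  assumes "decidable_in B P" shows "decidable_in B (\<lambda>x. \<not> P x)"
proof -
  have eq: "of_bool (\<not> P x) = (if P x then 0 else (1 :: nat))" for x by auto
  show ?thesis unfolding decidable_in_def eq by (intro cmp_if[OF assms] cmp_const)
qed

lemma dec_and [cmp]:
  assumes "decidable_in B P" "decidable_in B Q" shows "decidable_in B (\<lambda>x. P x \<and> Q x)"
proof -
  have eq: "of_bool (P x \<and> Q x) = (if P x then of_bool (Q x) else (0 :: nat))" for x by auto
  show ?thesis unfolding decidable_in_def eq
    by (rule cmp_if[OF assms(1) assms(2)[unfolded decidable_in_def] cmp_const])
qed

lemma dec_or [cmp]:
  assumes "decidable_in B P" "decidable_in B Q" shows "decidable_in B (\<lambda>x. P x \<or> Q x)"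
  using dec_not[OF dec_and[OF dec_not[OF assms(1)] dec_not[OF assms(2)]]] by simp

lemma dec_imp [cmp]:
  assumes "decidable_in B P" "decidable_in B Q" shows "decidable_in B (\<lambda>x. P x \<longrightarrow> Q x)"
  unfolding imp_conv_disj by (rule dec_or[OF dec_not[OF assms(1)] assms(2)])

lemma cmp_add [cmp]:
  assumes "computable_in B f" "computable_in B g" shows "computable_in B (\<lambda>x. f x + g x)"
proof -
  have eq: "m + n = rec_nat m (\<lambda>_ y. Suc y) n" for m n
    by (induction n) (simp_all only: add_0_right add_Suc_right nat.rec)
  show ?thesis unfolding eq by (intro cmp assms)
qed

lemma cmp_mult [cmp]:
  assumes "computable_in B f" "computable_in B g" shows "computable_in B (\<lambda>x. f x * g x)"
proof -
  have eq: "m * n = rec_nat 0 (\<lambda>_ y. y + m) n" for m n by (induction n) auto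
  show ?thesis unfolding eq by (intro cmp assms cmp_compose[OF assms(1)])
qed

lemma cmp_power [cmp]:
  assumes "computable_in B f" shows "computable_in B (\<lambda>x. c ^ f x)"
proof -
  have eq: "c ^ n = rec_nat 1 (\<lambda>_ y. y * c) n" for n by (induction n) auto
  show ?thesis unfolding eq by (intro cmp assms)
qed

lemma cmp_diff [cmp]:
  assumes "computable_in B f" "computable_in B g" shows "computable_in B (\<lambda>x. f x - g x)"
proof -
  have pred: "n - 1 = rec_nat 0 (\<lambda>i _. i) n" for n by (cases n) auto
  have eq: "m - n = rec_nat m (\<lambda>_ y. rec_nat 0 (\<lambda>i _. i) y) n" for m n
    by (induction n) (simp_all flip: pred)
  show ?thesis unfolding eq by (intro cmp assms)
qed

lemma dec_less [cmp]:
  assumes "computable_in B f" "computable_in B g" shows "decidable_in B (\<lambda>x. f x < g x)"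
  using dec_pos[OF cmp_diff[OF assms(2,1)]] by simp

lemma dec_le [cmp]:
  assumes "computable_in B f" "computable_in B g" shows "decidable_in B (\<lambda>x. f x \<le> g x)"
  using dec_not[OF dec_less[OF assms(2,1)]] by (simp add: not_less)

lemma dec_eq [cmp]:
  assumes "computable_in B f" "computable_in B g" shows "decidable_in B (\<lambda>x. f x = (g x :: nat))"
  using dec_and[OF dec_le[OF assms] dec_le[OF assms(2,1)]] by (simp add: eq_iff)

lemma dec_even [cmp]:
  assumes "computable_in B f" shows "decidable_in B (\<lambda>x. even (f x))"
proof -
  have eq: "(of_bool (even n) :: nat) = rec_nat 1 (\<lambda>_ y. 1 - y) n" for n by (induction n) auto
  show ?thesis unfolding decidable_in_def eq by (intro cmp assms)
qed

lemma dec_Ex_less [cmp]: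
  assumes "decidable_in B (\<lambda>z. P (pi1 z) (pi2 z))" "computable_in B k"
  shows "decidable_in B (\<lambda>x. \<exists>n<k x. P x n)"
proof -
  have eq: "of_bool (\<exists>n<m. P x n) = rec_nat 0 (\<lambda>n y. if P x n then 1 else y) m" for x m :: nat
  proof (induction m)
    case (Suc m)
    have "(\<exists>n<Suc m. P x n) \<longleftrightarrow> P x m \<or> (\<exists>n<m. P x n)" by (auto simp: less_Suc_eq)
    with Suc[symmetric] show ?case by simp
  qed simp
  have D: "decidable_in B (\<lambda>z. P (pi1 z) (pi1 (pi2 z)))"
    using cmp_compose[OF assms(1)[unfolded decidable_in_def], of "\<lambda>z. pr (pi1 z) (pi1 (pi2 z))"]
    unfolding decidable_in_def by (simp add: cmp_pr cmp_pi1 cmp_pi2 cmp_id)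
  have "computable_in B (\<lambda>x. rec_nat 0 (\<lambda>n y. if P x n then 1 else y) (k x))"
    by (intro cmp assms D)
  then show ?thesis by (simp add: decidable_in_def eq)
qed

lemma dec_All_less [cmp]:
  assumes "decidable_in B (\<lambda>z. P (pi1 z) (pi2 z))" "computable_in B k"
  shows "decidable_in B (\<lambda>x. \<forall>n<k x. P x n)"
  using dec_not[OF dec_Ex_less[OF dec_not[OF assms(1)] assms(2)]] by simp

text \<open>Nothing is claimed where no witness exists: the search for splittings below will succeed
  only on inputs that encode binary strings.\<close>

lemma search_program:
  assumes "decidable_in B (\<lambda>z. P (pi1 z) (pi2 z))"
  shows "\<exists>p. \<forall>x. (\<exists>n. P x n) \<longrightarrow> computes B p x (LEAST n. P x n)"
proof -
  have "computable_in B (\<lambda>z. of_bool (\<not> P (pi1 z) (pi2 z)))"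
    using dec_not[OF assms] by (simp add: decidable_in_def)
  then obtain p where p: "\<And>z. computes B p z (of_bool (\<not> P (pi1 z) (pi2 z)))"
    by (auto simp: computable_in_def)
  have p': "computes B p (pr x n) (of_bool (\<not> P x n))" for x n using p[of "pr x n"] by simp
  have "computes B (Minimize p) x (LEAST n. P x n)" if "\<exists>n. P x n" for x
  proof (rule computes_pr_intros(6))
    show "computes B p (pr x (LEAST n. P x n)) 0" using p'[of x "LEAST n. P x n"] LeastI_ex[OF that] by simp
    show "\<exists>y. y \<noteq> 0 \<and> computes B p (pr x i) y" if "i < (LEAST n. P x n)" for i
      using p'[of x i] not_less_Least[OF that] by (intro exI[of _ 1]) simp
  qed
  then show ?thesis by blast
qed

lemma cmp_Least:
  assumes "decidable_in B (\<lambda>z. P (pi1 z) (pi2 z))" "\<And>x. \<exists>n. P x n"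
  shows "computable_in B (\<lambda>x. LEAST n. P x n)"
  using search_program[OF assms(1)] assms(2) unfolding computable_in_def by blast

lemma cmp_div [cmp]:
  assumes "computable_in B f" "computable_in B g" shows "computable_in B (\<lambda>x. f x div g x)"
proof -
  \<comment> \<open>The disjunct \<open>g x = 0\<close> stops the search at once and yields 0, the
    value of a division by zero.\<close>
  have eq: "f x div g x = (LEAST q. f x < Suc q * g x \<or> g x = 0)" for x
  proof (rule Least_equality[symmetric])
    show "f x < Suc (f x div g x) * g x \<or> g x = 0"
      by (cases "g x = 0") (simp_all add: dividend_less_div_times)
    show "f x div g x \<le> q" if "f x < Suc q * g x \<or> g x = 0" for q
      using that less_mult_imp_div_less[of "f x" "Suc q" "g x"] by auto
  qed
  show ?thesis unfolding eq
  proof (rule cmp_Least)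
    show "decidable_in B (\<lambda>z. f (pi1 z) < Suc (pi2 z) * g (pi1 z) \<or> g (pi1 z) = 0)"
      by (intro cmp cmp_compose[OF assms(1)] cmp_compose[OF assms(2)])
    show "\<exists>n. f x < Suc n * g x \<or> g x = 0" for x
      by (intro exI[of _ "f x div g x"], cases "g x = 0") (simp_all add: dividend_less_div_times)
  qed
qed

section \<open>Codes of lists\<close>

lemma pi2_0: "pi2 0 = 0"
  using pi2_le[of 0] by simp

lemma list_decode_pi: "list_decode (Suc n) = pi1 n # list_decode (pi2 n)"
  by (simp add: pi1_def pi2_def split: prod.split)

lemma list_encode_pr: "list_encode (x # xs) = Suc (pr x (list_encode xs))"
  by (simp add: pr_def)

lemma cmp_drop [cmp]:
  assumes "computable_in B f" "computable_in B g"
  shows "computable_in B (\<lambda>x. list_encode (drop (f x) (list_decode (g x))))"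
proof -
  have tl: "list_encode (tl (list_decode c)) = pi2 (c - 1)" for c
    by (cases c) (simp_all add: pi2_0 list_decode_pi del: list_decode.simps(2))
  \<comment> \<open>Truncated subtraction and \<open>pi2 0 = 0\<close> keep 0, the code of the empty
    list, fixed.\<close>
  have eq: "list_encode (drop n (list_decode c)) = rec_nat c (\<lambda>_ y. pi2 (y - 1)) n" for n c
  proof (induction n)
    case (Suc n)
    have "drop (Suc n) (list_decode c) = tl (drop n (list_decode c))"
      by (simp add: drop_Suc tl_drop)
    then show ?case using Suc[symmetric] tl[of "list_encode (drop n (list_decode c))"] by simp
  qed simp
  show ?thesis unfolding eq by (intro cmp assms)
qed

lemma cmp_length [cmp]:
  assumes "computable_in B g"
  shows "computable_in B (\<lambda>x. length (list_decode (g x)))"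
proof -
  have nil: "list_encode xs = 0 \<longleftrightarrow> xs = []" for xs by (cases xs) auto
  have "computable_in B (\<lambda>x. LEAST n. list_encode (drop n (list_decode (g x))) = 0)"
    by (rule cmp_Least) (intro cmp cmp_compose[OF assms], auto simp: nil)
  moreover have "(LEAST n. list_encode (drop n xs) = 0) = length xs" for xs
    by (rule Least_equality) (auto simp: nil)
  ultimately show ?thesis by simp
qed

text \<open>Unlike \<^const>\<open>nth\<close>, this is well-behaved beyond the end of the list.\<close>
definition cnth :: "nat \<Rightarrow> nat \<Rightarrow> nat" where
  "cnth c k = pi1 (list_encode (drop k (list_decode c)) - 1)"

lemma cnth_eq: "k < length (list_decode c) \<Longrightarrow> cnth c k = list_decode c ! k"
  by (simp add: cnth_def Cons_nth_drop_Suc[symmetric] list_encode_pr del: list_encode.simps)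

lemma cmp_cnth [cmp]:
  "computable_in B f \<Longrightarrow> computable_in B g \<Longrightarrow> computable_in B (\<lambda>x. cnth (f x) (g x))"
  unfolding cnth_def by (intro cmp)

lemma cmp_take [cmp]:
  assumes "computable_in B f" "computable_in B g"
  shows "computable_in B (\<lambda>x. list_encode (take (f x) (list_decode (g x))))"
proof -
  define n where "n x = (if f x \<le> length (list_decode (g x)) then f x else length (list_decode (g x)))" for x
  \<comment> \<open>A list is determined by its length and entries, so an unbounded search finds the
    prefix.\<close>
  define P where "P x z \<longleftrightarrow> length (list_decode z) = n x \<and>
      (\<forall>k<n x. cnth z k = cnth (g x) k)" for x z
  have n: "computable_in B n" unfolding n_def by (intro cmp assms)
  have iff: "P x z \<longleftrightarrow> z = list_encode (take (f x) (list_decode (g x)))" for x z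
  proof -
    have "P x z \<longleftrightarrow> list_decode z = take (f x) (list_decode (g x))"
      by (auto simp: P_def n_def list_eq_iff_nth_eq cnth_eq min_def)
    then show ?thesis by (metis list_decode_inverse list_encode_inverse)
  qed
  have "decidable_in B (\<lambda>z. P (pi1 z) (pi2 z))"
    unfolding P_def by (intro cmp cmp_compose[OF n] cmp_compose[OF assms(2)])
  then have "computable_in B (\<lambda>x. LEAST z. P x z)" by (rule cmp_Least) (auto simp: iff)
  then show ?thesis by (simp add: iff Least_equality)
qed

lemma dec_Bex_list [cmp]:
  assumes "decidable_in B (\<lambda>z. P (pi1 z) (pi2 z))" "computable_in B c"
  shows "decidable_in B (\<lambda>x. \<exists>e\<in>set (list_decode (c x)). P x e)"
proof -
  have eq: "(\<exists>e\<in>set (list_decode (c x)). P x e) \<longleftrightarrow> (\<exists>k<length (list_decode (c x)). P x (cnth (c x) k))" for x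
    by (metis cnth_eq in_set_conv_nth)
  have "decidable_in B (\<lambda>z. P (pi1 z) (cnth (c (pi1 z)) (pi2 z)))"
    using cmp_compose[OF assms(1)[unfolded decidable_in_def], of "\<lambda>z. pr (pi1 z) (cnth (c (pi1 z)) (pi2 z))"]
      cmp_compose[OF assms(2)]
    unfolding decidable_in_def by (simp add: cmp_pr cmp_pi1 cmp_pi2 cmp_id cmp_cnth)
  then show ?thesis unfolding eq by (intro cmp assms)
qed

lemma dec_mem_list [cmp]:
  assumes "computable_in B f" "computable_in B c"
  shows "decidable_in B (\<lambda>x. f x \<in> set (list_decode (c x)))"
proof -
  have eq: "f x \<in> set (list_decode (c x)) \<longleftrightarrow> (\<exists>e\<in>set (list_decode (c x)). e = f x)" for x by auto
  show ?thesis unfolding eq by (intro cmp assms cmp_compose[OF assms(1)])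
qed

section \<open>Certificates of computations\<close>

fun prog_code :: "prog \<Rightarrow> nat" where
  "prog_code Zero = pr 0 0"
| "prog_code Succ = pr 1 0"
| "prog_code Left = pr 2 0"
| "prog_code Right = pr 3 0"
| "prog_code Query = pr 4 0"
| "prog_code (Pair p q) = pr 5 (pr (prog_code p) (prog_code q))"
| "prog_code (Comp p q) = pr 6 (pr (prog_code p) (prog_code q))"
| "prog_code (PrimRec p q) = pr 7 (pr (prog_code p) (prog_code q))"
| "prog_code (Minimize p) = pr 8 (pr (prog_code p) 0)"

definition entry :: "nat \<Rightarrow> nat \<Rightarrow> nat \<Rightarrow> nat" where
  "entry p x y = pr p (pr x y)"

abbreviation (input) "entry_prog e \<equiv> pi1 e"
abbreviation (input) "entry_arg e \<equiv> pi1 (pi2 e)"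
abbreviation (input) "entry_val e \<equiv> pi2 (pi2 e)"

text \<open>\<open>justified Q e S\<close>: the entry \<open>e\<close> follows by one rule of \<^const>\<open>computes\<close>, with oracle answers \<open>Q\<close>,
  from entries in \<open>S\<close>.\<close>
definition justified :: "(nat \<Rightarrow> nat) \<Rightarrow> nat \<Rightarrow> nat set \<Rightarrow> bool" where
  "justified Q e S \<longleftrightarrow> (let p = entry_prog e; x = entry_arg e; y = entry_val e;
      t = pi1 p; a = pi1 (pi2 p); b = pi2 (pi2 p) in
    t = 0 \<and> y = 0 \<or> t = 1 \<and> y = Suc x \<or> t = 2 \<and> y = pi1 x \<or> t = 3 \<and> y = pi2 x \<or>
    t = 4 \<and> y = Q x \<or>
    t = 5 \<and> entry a x (pi1 y) \<in> S \<and> entry b x (pi2 y) \<in> S \<or>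
    t = 6 \<and> (\<exists>e'\<in>S. entry_prog e' = b \<and> entry_arg e' = x \<and> entry a (entry_val e') y \<in> S) \<or>
    t = 7 \<and> pi2 x = 0 \<and> entry a (pi1 x) y \<in> S \<or>
    t = 7 \<and> 0 < pi2 x \<and> (\<exists>e'\<in>S. entry_prog e' = p \<and> entry_arg e' = pr (pi1 x) (pi2 x - 1) \<and>
      entry b (pr (pi1 x) (pr (pi2 x - 1) (entry_val e'))) y \<in> S) \<or>
    t = 8 \<and> entry a (pr x y) 0 \<in> S \<and>
      (\<forall>i<y. \<exists>e'\<in>S. entry_prog e' = a \<and> entry_arg e' = pr x i \<and> 0 < entry_val e'))"

text \<open>Conclusions precede their premises, so the first entry is the result that the whole list
  certifies.\<close>

fun valid_cert :: "(nat \<Rightarrow> nat) \<Rightarrow> nat list \<Rightarrow> bool" where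
  "valid_cert Q [] \<longleftrightarrow> True"
| "valid_cert Q (e # es) \<longleftrightarrow> justified Q e (set es) \<and> valid_cert Q es"

lemma entry_simps [simp]:
  "pi1 (entry p x y) = p" "pi1 (pi2 (entry p x y)) = x" "pi2 (pi2 (entry p x y)) = y"
  by (simp_all add: entry_def)

lemma justified_simps:
  "justified Q (entry (prog_code Zero) x y) S \<longleftrightarrow> y = 0"
  "justified Q (entry (prog_code Succ) x y) S \<longleftrightarrow> y = Suc x"
  "justified Q (entry (prog_code Left) x y) S \<longleftrightarrow> y = pi1 x"
  "justified Q (entry (prog_code Right) x y) S \<longleftrightarrow> y = pi2 x"
  "justified Q (entry (prog_code Query) x y) S \<longleftrightarrow> y = Q x"
  "justified Q (entry (prog_code (Pair p q)) x y) S \<longleftrightarrow>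
    entry (prog_code p) x (pi1 y) \<in> S \<and> entry (prog_code q) x (pi2 y) \<in> S"
  "justified Q (entry (prog_code (Comp p q)) x y) S \<longleftrightarrow>
    (\<exists>e\<in>S. pi1 e = prog_code q \<and> pi1 (pi2 e) = x \<and> entry (prog_code p) (pi2 (pi2 e)) y \<in> S)"
  "justified Q (entry (prog_code (PrimRec p q)) (pr x 0) y) S \<longleftrightarrow> entry (prog_code p) x y \<in> S"
  "justified Q (entry (prog_code (PrimRec p q)) (pr x (Suc n)) y) S \<longleftrightarrow>
    (\<exists>e\<in>S. pi1 e = prog_code (PrimRec p q) \<and> pi1 (pi2 e) = pr x n \<and>
      entry (prog_code q) (pr x (pr n (pi2 (pi2 e)))) y \<in> S)"
  "justified Q (entry (prog_code (Minimize p)) x y) S \<longleftrightarrow> entry (prog_code p) (pr x y) 0 \<in> S \<and>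
      (\<forall>i<y. \<exists>e\<in>S. pi1 e = prog_code p \<and> pi1 (pi2 e) = pr x i \<and> 0 < pi2 (pi2 e))"
  by (simp_all add: justified_def Let_def)

lemma justified_mono:
  assumes "justified Q e S" "S \<subseteq> T" shows "justified Q e T"
proof -
  have bex: "(\<exists>e\<in>S. P e) \<longrightarrow> (\<exists>e\<in>T. R e)" if "\<And>e. P e \<longrightarrow> R e" for P R :: "nat \<Rightarrow> bool"
    using that assms(2) by blast
  have mem: "x \<in> S \<longrightarrow> x \<in> T" for x using assms(2) by blast
  have "justified Q e S \<longrightarrow> justified Q e T"
    unfolding justified_def Let_def
    by (rule imp_refl mem disj_mono conj_mono bex all_mono imp_mono)+
  then show ?thesis using assms(1) by blast
qed

lemma valid_cert_append: "valid_cert Q xs \<Longrightarrow> valid_cert Q ys \<Longrightarrow> valid_cert Q (xs @ ys)"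
  by (induction xs) (auto elim: justified_mono)

text \<open>An entry consults the oracle at most at its own argument. Hence finitely many bits
  decide validity, and the decoder can check a certificate from a prefix of
  \<open>A\<close>.\<close>

lemma valid_cert_cong:
  "(\<And>e. e \<in> set xs \<Longrightarrow> Q (entry_arg e) = R (entry_arg e)) \<Longrightarrow> valid_cert Q xs \<longleftrightarrow> valid_cert R xs"
  by (induction xs) (auto simp: justified_def Let_def)

lemma valid_cert_iff_nth:
  "valid_cert Q xs \<longleftrightarrow> (\<forall>i<length xs. justified Q (xs ! i) (set (drop (Suc i) xs)))"
  by (induction xs) (auto simp: All_less_Suc2)

lemma valid_cert_sound:
  assumes "valid_cert (\<lambda>x. of_bool (A x)) xs" "entry (prog_code p) x y \<in> set xs"
  shows "computes A p x y"
  using assms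
proof (induction xs arbitrary: p x y)
  case (Cons e es)
  show ?case
  proof (cases "entry (prog_code p) x y \<in> set es")
    case False
    then have j: "justified (\<lambda>x. of_bool (A x)) (entry (prog_code p) x y) (set es)" using Cons by auto
    have IH: "computes A q x y" if "entry (prog_code q) x y \<in> set es" for q x y
      using that Cons by auto
    have IH': "computes A q (entry_arg z) (entry_val z)" if "z \<in> set es" "entry_prog z = prog_code q" for q z
      using that IH[of q "entry_arg z" "entry_val z"] by (metis entry_def pi_pr(3))
    show ?thesis
    proof (cases p)
      case Zero then show ?thesis using j by (simp add: justified_simps computes.zero del: prog_code.simps)
    next
      case Succ then show ?thesis using j by (simp add: justified_simps computes.succ del: prog_code.simps)
    next
      case Left then show ?thesis using j by (simp add: justified_simps computes_pi del: prog_code.simps)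
    next
      case Right then show ?thesis using j by (simp add: justified_simps computes_pi del: prog_code.simps)
    next
      case Query
      have "y = of_bool (A x)" using j Query by (simp add: justified_simps del: prog_code.simps)
      then show ?thesis using Query computes.query[of A x] by simp
    next
      case (Pair q r)
      then have "computes A q x (pi1 y)" "computes A r x (pi2 y)"
        using j by (simp_all add: justified_simps IH del: prog_code.simps)
      then show ?thesis using computes_pr_intros(3)[of A q x "pi1 y" r "pi2 y"] Pair by simp
    next
      case (Comp q r)
      then obtain z where "z \<in> set es" "pi1 z = prog_code r" "pi1 (pi2 z) = x"
        "entry (prog_code q) (pi2 (pi2 z)) y \<in> set es"
        using j by (auto simp: justified_simps simp del: prog_code.simps)
      then have "computes A r x (pi2 (pi2 z))" "computes A q (pi2 (pi2 z)) y"
        using IH' IH by force+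
      then show ?thesis using Comp by (auto intro: computes.comp)
    next
      case (PrimRec q r)
      define a n where "a = pi1 x" and "n = pi2 x"
      have x: "x = pr a n" by (simp add: a_def n_def)
      show ?thesis
      proof (cases n)
        case 0
        then show ?thesis using j PrimRec
          by (simp add: x justified_simps computes_pr_intros IH del: prog_code.simps)
      next
        case (Suc m)
        then obtain z where "z \<in> set es" "pi1 z = prog_code p" "pi1 (pi2 z) = pr a m"
          "entry (prog_code r) (pr a (pr m (pi2 (pi2 z)))) y \<in> set es"
          using j PrimRec by (auto simp: x justified_simps simp del: prog_code.simps)
        then have "computes A p (pr a m) (pi2 (pi2 z))" "computes A r (pr a (pr m (pi2 (pi2 z)))) y"
          using IH' IH by force+
        then show ?thesis using PrimRec Suc x by (auto intro: computes_pr_intros)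
      qed
    next
      case (Minimize q)
      then have 1: "entry (prog_code q) (pr x y) 0 \<in> set es" and
        2: "\<forall>i<y. \<exists>z\<in>set es. pi1 z = prog_code q \<and> pi1 (pi2 z) = pr x i \<and> 0 < pi2 (pi2 z)"
        using j by (auto simp: justified_simps simp del: prog_code.simps)
      have "\<exists>v. v \<noteq> 0 \<and> computes A q (pr x i) v" if "i < y" for i
        using 2 that IH' by (metis less_not_refl2)
      then show ?thesis using Minimize IH[OF 1] by (auto intro: computes_pr_intros(6))
    qed
  qed (use Cons in auto)
qed simp

lemma computes_certificate:
  assumes "computes A p x y"
  shows "\<exists>xs. valid_cert (\<lambda>x. of_bool (A x)) (entry (prog_code p) x y # xs)"
  using assms
proof induction
  case (pair p x y q z)
  then obtain xs ys where "valid_cert (\<lambda>x. of_bool (A x)) (entry (prog_code p) x y # xs)"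
    "valid_cert (\<lambda>x. of_bool (A x)) (entry (prog_code q) x z # ys)" by blast
  note v = valid_cert_append[OF this]
  show ?case
    by (rule exI, subst valid_cert.simps, rule conjI[OF _ v])
       (simp add: justified_simps del: prog_code.simps, simp add: pi1_def pi2_def)
next
  case (comp q x y p z)
  then obtain xs ys where "valid_cert (\<lambda>x. of_bool (A x)) (entry (prog_code q) x y # xs)"
    "valid_cert (\<lambda>x. of_bool (A x)) (entry (prog_code p) y z # ys)" by blast
  note v = valid_cert_append[OF this]
  show ?case
    by (rule exI, subst valid_cert.simps, rule conjI[OF _ v]) (force simp: justified_simps simp del: prog_code.simps)
next
  case (prim_rec_0 p x y q)
  then obtain xs where v: "valid_cert (\<lambda>x. of_bool (A x)) (entry (prog_code p) x y # xs)" by blast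
  show ?case
    by (rule exI, subst valid_cert.simps, rule conjI[OF _ v])
       (force simp: justified_simps simp del: prog_code.simps simp flip: pr_def)
next
  case (prim_rec_Suc p q x n y z)
  then obtain xs ys where
    "valid_cert (\<lambda>x. of_bool (A x)) (entry (prog_code (PrimRec p q)) (pr x n) y # xs)"
    "valid_cert (\<lambda>x. of_bool (A x)) (entry (prog_code q) (pr x (pr n y)) z # ys)"
    unfolding pr_def by blast
  note v = valid_cert_append[OF this]
  show ?case
    by (rule exI, subst valid_cert.simps, rule conjI[OF _ v])
       (force simp: justified_simps simp del: prog_code.simps simp flip: pr_def)
next
  case (minimize p x n)
  obtain ys where ys: "valid_cert (\<lambda>x. of_bool (A x)) (entry (prog_code p) (pr x n) 0 # ys)"
    using minimize unfolding pr_def by blast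
  \<comment> \<open>The values before the first zero need one certificate each; these are
    concatenated by induction on \<open>k\<close>.\<close>
  have "\<exists>xs. valid_cert (\<lambda>x. of_bool (A x)) xs \<and>
      (\<forall>i<k. \<exists>e\<in>set xs. pi1 e = prog_code p \<and> pi1 (pi2 e) = pr x i \<and> 0 < pi2 (pi2 e))"
    if "k \<le> n" for k
    using that
  proof (induction k)
    case (Suc k)
    then obtain xs where xs: "valid_cert (\<lambda>x. of_bool (A x)) xs"
      "\<forall>i<k. \<exists>e\<in>set xs. pi1 e = prog_code p \<and> pi1 (pi2 e) = pr x i \<and> 0 < pi2 (pi2 e)" by auto
    from minimize Suc.prems obtain y zs where y: "y \<noteq> 0"
      and zs: "valid_cert (\<lambda>x. of_bool (A x)) (entry (prog_code p) (pr x k) y # zs)"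
      unfolding pr_def by (meson Suc_le_eq)
    from xs(2) y have "\<forall>i<Suc k. \<exists>e\<in>set ((entry (prog_code p) (pr x k) y # zs) @ xs).
        pi1 e = prog_code p \<and> pi1 (pi2 e) = pr x i \<and> 0 < pi2 (pi2 e)"
      by (auto simp: less_Suc_eq)
    then show ?case using valid_cert_append[OF zs xs(1)] by blast
  qed (auto intro: exI[of _ "[]"])
  then obtain xs where xs: "valid_cert (\<lambda>x. of_bool (A x)) xs"
    "\<forall>i<n. \<exists>e\<in>set xs. pi1 e = prog_code p \<and> pi1 (pi2 e) = pr x i \<and> 0 < pi2 (pi2 e)" by blast
  have j: "justified (\<lambda>x. of_bool (A x)) (entry (prog_code (Minimize p)) x n)
      (set ((entry (prog_code p) (pr x n) 0 # ys) @ xs))"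
    using xs(2) unfolding justified_simps by auto
  show ?case
    by (rule exI, subst valid_cert.simps, rule conjI[OF j valid_cert_append[OF ys xs(1)]])
next
  case (zero x)
  show ?case by (rule exI[of _ "[]"]) (simp add: justified_simps(1) del: prog_code.simps)
next
  case (succ x)
  show ?case by (rule exI[of _ "[]"]) (simp add: justified_simps(2) del: prog_code.simps)
next
  case (left x y)
  show ?case by (rule exI[of _ "[]"]) (simp add: justified_simps(3) del: prog_code.simps flip: pr_def)
next
  case (right x y)
  show ?case by (rule exI[of _ "[]"]) (simp add: justified_simps(4) del: prog_code.simps flip: pr_def)
next
  case (query x)
  show ?case by (rule exI[of _ "[]"]) (simp add: justified_simps(5) del: prog_code.simps)
qed

text \<open>Padding with trivial entries makes the code as large as desired, so a certificate still
  turns up after any given time.\<close>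

lemma computes_large_certificate:
  assumes "computes A p x y"
  shows "\<exists>xs. valid_cert (\<lambda>x. of_bool (A x)) (entry (prog_code p) x y # xs) \<and> length xs \<ge> n"
proof -
  obtain xs where xs: "valid_cert (\<lambda>x. of_bool (A x)) (entry (prog_code p) x y # xs)"
    using computes_certificate[OF assms] by blast
  have "valid_cert (\<lambda>x. of_bool (A x)) (replicate n (entry (pr 0 0) 0 0))"
    by (induction n) (simp_all add: justified_simps(1)[simplified])
  from valid_cert_append[OF xs this] show ?thesis
    by (intro exI[of _ "xs @ replicate n (entry (pr 0 0) 0 0)"]) simp
qed

text \<open>The decoder acts on the first certificate it meets, which may differ from the one known
  to exist; both must name the same output.\<close>

lemma computes_deterministic:
  assumes "computes A p x y" "computes A p x z" shows "y = z"
  using assms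
proof (induction arbitrary: z)
  case (minimize p x n)
  from minimize.prems have v: "computes A p (prod_encode (x, z)) 0 \<and>
      (\<forall>i<z. \<exists>y. y \<noteq> 0 \<and> computes A p (prod_encode (x, i)) y)"
    by cases simp_all
  show ?case
  proof (rule linorder_cases[of n z])
    assume "n < z"
    then show ?thesis using v minimize.IH(1) by metis
  next
    assume "z < n"
    then show ?thesis using v minimize.IH(2) by metis
  qed
next
  case (comp q x y p z')
  from comp.prems obtain y' where "computes A q x y'" "computes A p y' z" by cases
  with comp.IH show ?case by metis
next
  case (pair p x y q z')
  from pair.prems obtain y1 z1 where "computes A p x y1" "computes A q x z1" "z = prod_encode (y1, z1)" by cases
  with pair.IH show ?case by metis
next
  case (prim_rec_0 p x y q)
  from prim_rec_0.prems have "computes A p x z" by cases auto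
  with prim_rec_0.IH show ?case by metis
next
  case (prim_rec_Suc p q x n y z')
  from prim_rec_Suc.prems obtain y' where
    "computes A (PrimRec p q) (prod_encode (x, n)) y'" "computes A q (prod_encode (x, prod_encode (n, y'))) z"
    by cases auto
  with prim_rec_Suc.IH show ?case by metis
qed (erule computes.cases; simp)+

lemma length_le_list_encode: "length xs \<le> list_encode xs"
proof (induction xs)
  case (Cons x xs)
  have "list_encode xs \<le> prod_encode (x, list_encode xs)" by (rule le_prod_encode_2)
  with Cons show ?case by simp
qed simp

lemma mem_less_list_encode: "x \<in> set xs \<Longrightarrow> x < list_encode xs"
proof (induction xs)
  case (Cons y ys)
  have "list_encode ys \<le> prod_encode (y, list_encode ys)" "y \<le> prod_encode (y, list_encode ys)"
    by (rule le_prod_encode_2, rule le_prod_encode_1)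
  with Cons show ?case by force
qed simp

text \<open>Oracle answers are read off the even positions, where a join carries the bits of
  \<open>A\<close>. The recursion over tails becomes a bounded quantifier over positions.\<close>

lemma dec_valid_cert [cmp]:
  assumes "computable_in B f" "computable_in B c"
  shows "decidable_in B (\<lambda>x. valid_cert (\<lambda>i. cnth (f x) (2 * i)) (list_decode (c x)))"
proof -
  have eq: "valid_cert Q (list_decode n) \<longleftrightarrow> (\<forall>i<length (list_decode n). justified Q (cnth n i)
     (set (list_decode (list_encode (drop (Suc i) (list_decode n))))))" for Q n
    by (simp add: valid_cert_iff_nth cnth_eq del: drop_Suc)
  show ?thesis unfolding eq justified_def Let_def entry_def
    by (intro cmp assms cmp_compose[OF assms(1)] cmp_compose[OF assms(2)])
qed

section \<open>The betting decoder\<close>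

lemma list_decode_string_encode [simp]: "list_decode (string_encode w) = map of_bool w"
  by (simp add: string_encode_def)

lemma cnth_string_encode: "k < length w \<Longrightarrow> cnth (string_encode w) k = of_bool (w ! k)"
  by (simp add: cnth_eq)

lemma string_encode_take:
  "list_encode (take n (list_decode (string_encode w))) = string_encode (take n w)"
  by (simp add: string_encode_def take_map)

lemma length_le_string_encode: "length w \<le> string_encode w"
  using length_le_list_encode[of "map of_bool w"] by (simp add: string_encode_def)

text \<open>Here \<open>w\<close> encodes a prefix of a join, which has the bits of \<open>B\<close> at the odd indices.\<close>
definition matches :: "nat \<Rightarrow> nat \<Rightarrow> bool" where
  "matches u w \<longleftrightarrow> (\<forall>k<length (list_decode u). cnth u k = cnth w (Suc (2 * k)))"

text \<open>Capital \<open>c\<close>, code \<open>p\<close> of the current splitting program and its first input \<open>d\<close>, code \<open>s\<close> of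
  the part of \<open>B\<close> decoded so far, and number \<open>q\<close> announced so far.\<close>
definition state :: "nat \<Rightarrow> nat \<Rightarrow> nat \<Rightarrow> nat \<Rightarrow> nat \<Rightarrow> nat" where
  "state c p d s q = pr c (pr p (pr d (pr s q)))"

text \<open>The value of the first entry is left open: it is the output that the decoder wants to
  learn. The condition \<open>0 < r\<close> makes the list nonempty.\<close>

definition active :: "nat \<Rightarrow> nat \<Rightarrow> nat \<Rightarrow> (nat \<Rightarrow> nat) \<Rightarrow> bool" where
  "active r p x Q \<longleftrightarrow> 0 < r \<and> pi1 (cnth r 0) = p \<and> pi1 (pi2 (cnth r 0)) = x \<and> valid_cert Q (list_decode r)"

text \<open>After 2r bits the next bit of a join is bit r of \<open>A\<close>, and the number r
  itself is tested as a certificate. The whole capital is staked, \<open>v0\<close> standing for the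
  forecast 0 and \<open>v1\<close> for 1. On these two branches the announced number becomes the
  program, and the new string is both the decoded part and the input \<open>d\<close>.\<close>

definition step :: "nat \<Rightarrow> nat \<Rightarrow> nat \<Rightarrow> nat" where
  "step S w b = (let c = pi1 S; p = pi1 (pi2 S); d = pi1 (pi2 (pi2 S));
      s = pi1 (pi2 (pi2 (pi2 S))); q = pi2 (pi2 (pi2 (pi2 S)));
      r = length (list_decode w) div 2; y = pi2 (pi2 (cnth r 0));
      u = pi1 y; v0 = pi1 (pi2 y); v1 = pi2 (pi2 y) in
    if even (length (list_decode w)) \<and> active r p (pr d s) (\<lambda>i. cnth w (2 * i)) then
      if matches u w then state c p d u (Suc q)
      else if matches v0 w then state (if 0 < b then 0 else 2 * c) q v0 v0 0
      else if matches v1 w then state (if 0 < b then 2 * c else 0) q v1 v1 0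
      else S
    else S)"

definition run :: "nat \<Rightarrow> nat \<Rightarrow> nat" where
  "run S c = rec_nat S (\<lambda>i S. step S (list_encode (take i (list_decode c))) (cnth c i))
     (length (list_decode c))"

lemma cmp_run [cmp]: "computable_in B f \<Longrightarrow> computable_in B (\<lambda>x. run S (f x))"
  unfolding run_def step_def Let_def matches_def active_def state_def
  by (rule cmp_compose[of B _ f]) (intro cmp)

lemma rec_nat_cong:
  assumes "\<And>i S. i < n \<Longrightarrow> f i S = g i S"
  shows "rec_nat a f n = rec_nat a g n"
  using assms by (induction n) auto

lemma run_Nil: "run S (string_encode []) = S"
  by (simp add: run_def string_encode_def)

lemma run_snoc:
  "run S (string_encode (w @ [b])) = step (run S (string_encode w)) (string_encode w) (of_bool b)"
proof -
  have "step T (string_encode (take i (w @ [b]))) (cnth (string_encode (w @ [b])) i) =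
        step T (string_encode (take i w)) (cnth (string_encode w) i)" if "i < length w" for i T
    using that by (simp add: cnth_string_encode nth_append)
  then have "rec_nat S (\<lambda>i T. step T (string_encode (take i (w @ [b]))) (cnth (string_encode (w @ [b])) i)) (length w) =
      rec_nat S (\<lambda>i T. step T (string_encode (take i w)) (cnth (string_encode w) i)) (length w)"
    by (rule rec_nat_cong)
  then show ?thesis
    unfolding run_def string_encode_take by (simp add: cnth_string_encode)
qed

definition capital :: "nat \<Rightarrow> bool list \<Rightarrow> real" where
  "capital S w = real (pi1 (run S (string_encode w)))"

text \<open>A step either treats the capital alike for both values of the bit, or doubles it for one
  value and loses it for the other.\<close>

lemma martingale_capital: "martingale (capital S)"
  unfolding martingale_def
proof (intro conjI allI)
  fix w
  have "2 * pi1 T = pi1 (step T w 0) + pi1 (step T w 1)" for T w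
    by (simp add: step_def Let_def state_def)
  then show "capital S w = (capital S (w @ [False]) + capital S (w @ [True])) / 2"
    by (simp add: capital_def run_snoc flip: of_nat_add)
qed (simp add: capital_def)

lemma int_decode_double: "int_decode (2 * m) = int m"
proof -
  have "int_encode (int m) = 2 * m" by (simp add: int_encode_def sum_encode_def)
  then show ?thesis by (metis int_encode_inverse)
qed

lemma real_computable_capital: "real_computable_in B (capital S)"
proof -
  \<comment> \<open>The capital is a natural number and is output exactly; the factor 2 is due to
    nonnegative integers having even codes.\<close>
  define g where "g z = 2 * (pi1 (run S (pi1 z)) * 2 ^ pi2 z)" for z
  have "computable_in B g" unfolding g_def by (intro cmp)
  moreover have "\<bar>capital S w - of_int (int_decode (g (prod_encode (string_encode w, n)))) / 2 ^ n\<bar> \<le> 1 / 2 ^ n" for w n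
    by (simp add: g_def int_decode_double capital_def flip: pr_def)
  ultimately show ?thesis unfolding real_computable_in_def by blast
qed

section \<open>The decoder on a join\<close>

definition join :: "(nat \<Rightarrow> bool) \<Rightarrow> (nat \<Rightarrow> bool) \<Rightarrow> nat \<Rightarrow> bool" where
  "join A B n = (if even n then A (n div 2) else B (n div 2))"

definition extends :: "(nat \<Rightarrow> bool) \<Rightarrow> bool list \<Rightarrow> bool" where
  "extends B s \<longleftrightarrow> (\<forall>k<length s. B k = s ! k)"

definition incomparable :: "bool list \<Rightarrow> bool list \<Rightarrow> bool" where
  "incomparable u v \<longleftrightarrow> (\<exists>k. k < length u \<and> k < length v \<and> u ! k \<noteq> v ! k)"

lemma not_extends_incomparable: "incomparable u v \<or> incomparable v u \<Longrightarrow> extends B u \<Longrightarrow> \<not> extends B v"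
  by (auto simp: incomparable_def extends_def)

lemma prefix_of_seq_Suc: "prefix_of_seq A (Suc n) = prefix_of_seq A n @ [A n]"
  by (simp add: prefix_of_seq_def)

lemma length_prefix_of_seq [simp]: "length (prefix_of_seq A n) = n"
  by (simp add: prefix_of_seq_def)

lemma nth_prefix_of_seq [simp]: "k < n \<Longrightarrow> prefix_of_seq A n ! k = A k"
  by (simp add: prefix_of_seq_def)

text \<open>Quantifying over all continuations of \<open>s\<close> suits a construction by finite
  extension: the state at time \<open>t\<close> is settled before the later bits of \<open>B\<close>
  are chosen.\<close>

definition reaches :: "(nat \<Rightarrow> bool) \<Rightarrow> nat \<Rightarrow> nat \<Rightarrow> nat \<Rightarrow> nat \<Rightarrow> bool list \<Rightarrow> nat \<Rightarrow> nat \<Rightarrow> bool" where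
  "reaches A S c p d s q t \<longleftrightarrow> (\<forall>B. extends B s \<longrightarrow>
     run S (string_encode (prefix_of_seq (join A B) (2 * t))) = state c p d (string_encode s) q)"

text \<open>The arguments in the list coded by \<open>r\<close> are all smaller than
  \<open>r\<close>, so the first \<open>r\<close> bits of \<open>A\<close> answer every oracle
  question in it.\<close>

lemma active_prefix_iff:
  "active r p x (\<lambda>i. cnth (string_encode (prefix_of_seq (join A B) (2 * r))) (2 * i)) \<longleftrightarrow>
   active r p x (\<lambda>i. of_bool (A i))"
proof -
  have "cnth (string_encode (prefix_of_seq (join A B) (2 * r))) (2 * pi1 (pi2 e)) = of_bool (A (pi1 (pi2 e)))"
    if "e \<in> set (list_decode r)" for e
  proof -
    have "pi1 (pi2 e) < r"
      using mem_less_list_encode[OF that] pi1_le[of "pi2 e"] pi2_le[of e] by simp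
    then show ?thesis by (simp add: cnth_string_encode join_def)
  qed
  then show ?thesis unfolding active_def by (metis (no_types, lifting) valid_cert_cong)
qed

lemma matches_prefix_iff:
  assumes "length u \<le> r"
  shows "matches (string_encode u) (string_encode (prefix_of_seq (join A B) (2 * r))) \<longleftrightarrow> extends B u"
proof -
  have "cnth (string_encode u) k = of_bool (u ! k)"
    "cnth (string_encode (prefix_of_seq (join A B) (2 * r))) (Suc (2 * k)) = of_bool (B k)"
    if "k < length u" for k
    using that assms by (simp_all add: cnth_string_encode join_def)
  then have "matches (string_encode u) (string_encode (prefix_of_seq (join A B) (2 * r))) \<longleftrightarrow>
      (\<forall>k<length u. (of_bool (u ! k) :: nat) = of_bool (B k))"
    unfolding matches_def by simp
  then show ?thesis by (auto simp: extends_def)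
qed

lemma run_odd: "run S (string_encode (prefix_of_seq C (Suc (Suc (2 * r))))) =
    run S (string_encode (prefix_of_seq C (Suc (2 * r))))"
  by (simp add: prefix_of_seq_Suc[of C "Suc (2 * r)"] run_snoc step_def Let_def)

lemma run_Suc:
  "run S (string_encode (prefix_of_seq C (2 * Suc r))) =
   step (run S (string_encode (prefix_of_seq C (2 * r)))) (string_encode (prefix_of_seq C (2 * r))) (of_bool (C (2 * r)))"
  by (simp add: run_odd) (simp add: prefix_of_seq_Suc run_snoc)

lemma step_idle:
  assumes "\<not> active r p (pr d s) (\<lambda>i. of_bool (A i))"
  shows "step (state c p d s q) (string_encode (prefix_of_seq (join A B) (2 * r))) b = state c p d s q"
  using assms by (simp add: step_def Let_def active_prefix_iff) (simp add: state_def active_prefix_iff)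

text \<open>The time \<open>r\<close> of the first certificate from \<open>t\<close> on depends on
  \<open>A\<close> but not on the extension of \<open>s\<close> that is taken. The bit
  \<open>A r\<close> is thus fixed before the choice between \<open>v0\<close> and
  \<open>v1\<close>, and one of them wins the bet.\<close>

lemma reaches_split:
  assumes R: "reaches A S c (prog_code p) d s q t"
    and comp: "computes A p (pr d (string_encode s)) (pr (string_encode u) (pr (string_encode v0) (string_encode v1)))"
    and ext: "take (length s) u = s" "take (length s) v0 = s" "take (length s) v1 = s"
    and inc: "incomparable u v0" "incomparable u v1" "incomparable v0 v1"
  shows "\<exists>t'>t. reaches A S c (prog_code p) d u (Suc q) t' \<and>
    (\<exists>z\<in>{v0, v1}. reaches A S (2 * c) q (string_encode z) z 0 t')"
proof -
  define x where "x = pr d (string_encode s)"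
  define y where "y = pr (string_encode u) (pr (string_encode v0) (string_encode v1))"
  define act where "act r \<longleftrightarrow> active r (prog_code p) x (\<lambda>i. of_bool (A i))" for r
  obtain xs where xs: "valid_cert (\<lambda>x. of_bool (A x)) (entry (prog_code p) x y # xs)" "length xs \<ge> t"
    using computes_large_certificate[OF comp] unfolding x_def y_def by blast
  define r0 where "r0 = list_encode (entry (prog_code p) x y # xs)"
  have r0_dec: "list_decode r0 = entry (prog_code p) x y # xs" unfolding r0_def by (rule list_encode_inverse)
  have "r0 > t" using length_le_list_encode[of "entry (prog_code p) x y # xs"] xs(2) unfolding r0_def
    by (metis Suc_le_lessD length_Cons le_trans not_less_eq_eq Suc_le_mono)
  moreover have "act r0"
    using xs(1) \<open>r0 > t\<close> by (simp add: act_def active_def r0_dec cnth_eq)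
  ultimately have ex: "\<exists>r. r \<ge> t \<and> act r" by (meson less_imp_le)
  define r where "r = (LEAST r. r \<ge> t \<and> act r)"
  have r: "r \<ge> t" "act r" using LeastI_ex[OF ex] by (simp_all add: r_def)
  have before: "\<not> act i" if "t \<le> i" "i < r" for i
    using not_less_Least[of i "\<lambda>r. r \<ge> t \<and> act r"] that by (simp add: r_def)
  let ?C = "\<lambda>B. prefix_of_seq (join A B)"
  have wait: "run S (string_encode (?C B (2 * (t + i)))) = state c (prog_code p) d (string_encode s) q"
    if "extends B s" "t + i \<le> r" for B i
    using that(2)
  proof (induction i)
    case 0
    then show ?case using R that(1) by (simp add: reaches_def)
  next
    case (Suc i)
    have "\<not> act (t + i)" using before Suc.prems by simp
    then have "step (state c (prog_code p) d (string_encode s) q) (string_encode (?C B (2 * (t + i)))) b =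
        state c (prog_code p) d (string_encode s) q" for b
      unfolding act_def x_def by (rule step_idle)
    then show ?case using Suc.IH Suc.prems unfolding add_Suc_right run_Suc by simp
  qed
  \<comment> \<open>This certificate need not be the one built from \<open>xs\<close>, but soundness
    and determinism force its output to be \<open>y\<close>.\<close>
  have head: "cnth r 0 = entry (prog_code p) x y"
  proof -
    obtain e es where es: "list_decode r = e # es"
      using r(2) by (cases r) (auto simp: act_def active_def split: prod.splits)
    then have e: "cnth r 0 = e" by (simp add: cnth_eq)
    then have "e = entry (prog_code p) x (pi2 (pi2 e))"
      using r(2) unfolding act_def active_def entry_def by (metis pi_pr(3))
    then have "computes A p x (pi2 (pi2 e))"
      using valid_cert_sound[of A "list_decode r" p x "pi2 (pi2 e)"] r(2) es
      by (simp add: act_def active_def)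
    then have "pi2 (pi2 e) = y" using comp computes_deterministic unfolding x_def y_def by blast
    then show ?thesis using \<open>e = _\<close> e by simp
  qed
  have "entry (prog_code p) x y < r"
  proof -
    have "r > 0" using r(2) by (simp add: act_def active_def)
    then have "length (list_decode r) > 0" by (cases r) (auto split: prod.splits)
    then have "cnth r 0 \<in> set (list_decode r)" by (simp add: cnth_eq)
    from mem_less_list_encode[OF this] show ?thesis by (simp add: head)
  qed
  \<comment> \<open>Codes bound lengths, so the three strings have length at most \<open>r\<close>,
    and the \<open>r\<close> bits of \<open>B\<close> seen so far suffice to recognise them.\<close>
  then have "y < r" using pi2_le[of "entry (prog_code p) x y"] pi2_le[of "pi2 (entry (prog_code p) x y)"] by simp
  then have "string_encode u < r" "string_encode v0 < r" "string_encode v1 < r"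
    using pi1_le[of y] pi2_le[of y] pi1_le[of "pi2 y"] pi2_le[of "pi2 y"] unfolding y_def by simp_all
  then have len: "length u \<le> r" "length v0 \<le> r" "length v1 \<le> r"
    using length_le_string_encode by (meson le_trans less_imp_le)+
  have ext_s: "extends B s" if "extends B z" "take (length s) z = s" for B z
    unfolding extends_def
  proof (intro allI impI)
    fix k assume k: "k < length s"
    have "length s \<le> length z" using that(2) by (metis length_take min.cobounded1 min_def nat_le_linear)
    then show "B k = s ! k" using that k by (metis extends_def nth_take order_less_le_trans)
  qed
  have at: "run S (string_encode (?C B (2 * Suc r))) =
      (if extends B u then state c (prog_code p) d (string_encode u) (Suc q)
      else if extends B v0 then state (if A r then 0 else 2 * c) q (string_encode v0) (string_encode v0) 0
      else if extends B v1 then state (if A r then 2 * c else 0) q (string_encode v1) (string_encode v1) 0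
      else state c (prog_code p) d (string_encode s) q)" if "extends B s" for B
  proof -
    have "run S (string_encode (?C B (2 * r))) = state c (prog_code p) d (string_encode s) q"
      using wait[OF that, of "r - t"] r(1) by simp
    moreover have "active r (prog_code p) (pr d (string_encode s)) (\<lambda>i. cnth (string_encode (?C B (2 * r))) (2 * i))"
      using r(2) by (simp add: act_def x_def active_prefix_iff)
    moreover have "join A B (2 * r) = A r" by (simp add: join_def)
    ultimately show "run S (string_encode (?C B (2 * Suc r))) =
      (if extends B u then state c (prog_code p) d (string_encode u) (Suc q)
      else if extends B v0 then state (if A r then 0 else 2 * c) q (string_encode v0) (string_encode v0) 0
      else if extends B v1 then state (if A r then 2 * c else 0) q (string_encode v1) (string_encode v1) 0
      else state c (prog_code p) d (string_encode s) q)"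
      unfolding run_Suc by (simp add: step_def Let_def state_def head y_def matches_prefix_iff len)
  qed
  show ?thesis
  \<comment> \<open>The branch whose forecast agrees with \<open>A r\<close>.\<close>
  proof (intro exI[of _ "Suc r"] conjI bexI[of _ "if A r then v1 else v0"])
    show "Suc r > t" using r(1) by simp
    show "reaches A S c (prog_code p) d u (Suc q) (Suc r)"
      unfolding reaches_def using at ext_s[OF _ ext(1)] by simp
    show "reaches A S (2 * c) q (string_encode (if A r then v1 else v0)) (if A r then v1 else v0) 0 (Suc r)"
      unfolding reaches_def using at ext_s[OF _ ext(2)] ext_s[OF _ ext(3)]
        not_extends_incomparable[of u v0] not_extends_incomparable[of u v1] not_extends_incomparable[of v0 v1] inc
      by (auto split: if_splits)
  qed simp
qed

section \<open>Splitting programs\<close>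

lemma martingale_nonneg: "martingale f \<Longrightarrow> 0 \<le> f w"
  by (simp add: martingale_def)

lemma martingale_sum: "martingale f \<Longrightarrow> f (w @ [False]) + f (w @ [True]) = 2 * f w"
  unfolding martingale_def by (metis field_sum_of_halves mult_2)

lemma martingale_sum': "martingale f \<Longrightarrow> f (w @ [b]) + f (w @ [\<not> b]) = 2 * f w"
  using martingale_sum[of f w] by (cases b) auto

lemma martingaleI:
  assumes "\<And>w. 0 \<le> f w" "\<And>w. f (w @ [False]) + f (w @ [True]) = 2 * f w"
  shows "martingale f"
  using assms by (simp add: martingale_def)

lemma martingale_growth:
  assumes "martingale f" shows "f w \<le> 2 ^ length w * f []"
proof (induction w rule: rev_induct)
  case (snoc b w)
  have "f (w @ [b]) \<le> 2 * f w"
    using martingale_sum'[OF assms, of w b] martingale_nonneg[OF assms, of "w @ [\<not> b]"] by simp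
  with snoc show ?case by simp
qed simp

text \<open>Intermediate prefixes are included because the martingale must stay bounded along all of
  \<open>B\<close>, not only at the chosen strings.\<close>

definition controlled :: "(bool list \<Rightarrow> real) \<Rightarrow> real \<Rightarrow> bool list \<Rightarrow> bool list \<Rightarrow> bool" where
  "controlled f e s z \<longleftrightarrow> take (length s) z = s \<and> (\<forall>n\<ge>length s. f (take n z) \<le> f s + e)"

lemma take_eq_length_le: "take (length s) z = s \<Longrightarrow> length s \<le> length z"
  by (metis length_take min.cobounded1)

lemma controlled_self: "0 \<le> e \<Longrightarrow> controlled f e s s"
  by (simp add: controlled_def)

lemma controlled_le: "controlled f e s z \<Longrightarrow> f z \<le> f s + e"
  by (metis controlled_def take_eq_length_le order_refl take_all)

lemma controlled_trans:
  assumes "controlled f a s z" "controlled f b z w" "0 \<le> b"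
  shows "controlled f (a + b) s w"
  unfolding controlled_def
proof (intro conjI allI impI)
  have sz: "length s \<le> length z" using assms(1) by (simp add: controlled_def take_eq_length_le)
  then show "take (length s) w = s"
    using assms(1,2) unfolding controlled_def by (metis min.absorb1 take_take)
  fix n assume n: "length s \<le> n"
  show "f (take n w) \<le> f s + (a + b)"
  proof (cases "n \<le> length z")
    case True
    then have "take n w = take n z" using assms(2) unfolding controlled_def by (metis min.absorb1 take_take)
    then show ?thesis using assms(1,3) n unfolding controlled_def by force
  next
    case False
    then have "f (take n w) \<le> f z + b" using assms(2) unfolding controlled_def by simp
    then show ?thesis using controlled_le[OF assms(1)] by simp
  qed
qed

lemma controlled_mono: "controlled f a s z \<Longrightarrow> a \<le> b \<Longrightarrow> controlled f b s z"
  unfolding controlled_def by force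

lemma controlled_snoc:
  assumes "f (s @ [b]) \<le> f s + e" "0 \<le> e" shows "controlled f e s (s @ [b])"
  unfolding controlled_def
proof (intro conjI allI impI)
  fix n assume "length s \<le> n"
  then consider "n = length s" | "n \<ge> Suc (length s)" by linarith
  then show "f (take n (s @ [b])) \<le> f s + e" using assms by cases auto
qed simp

text \<open>A branch on which \<open>f\<close> would rise by more than \<open>e\<close> has a sibling on which it falls by more than \<open>e\<close>,
  which can happen only finitely often.\<close>
lemma branching_below:
  assumes f: "martingale f" and e: "0 < e"
  shows "\<exists>z. length s \<le> length z \<and> controlled f e s (z @ [False]) \<and> controlled f e s (z @ [True])"
proof -
  \<comment> \<open>\<open>m\<close> bounds how often \<open>f\<close> can still fall by more than
    \<open>e\<close> without becoming negative.\<close>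
  have "\<exists>z. length s \<le> length z \<and> controlled f e s (z @ [False]) \<and> controlled f e s (z @ [True])"
    if "f s < real m * e" for m
    using that
  proof (induction m arbitrary: s)
    case 0
    then show ?case using martingale_nonneg[OF f, of s] by simp
  next
    case (Suc m)
    show ?case
    proof (cases "\<forall>b. f (s @ [b]) \<le> f s + e")
      case True
      then show ?thesis using e by (intro exI[of _ s]) (auto intro!: controlled_snoc)
    next
      case False
      then obtain b where b: "f (s @ [b]) > f s + e" by (auto simp: not_le)
      then have b': "f (s @ [\<not> b]) < f s - e" using martingale_sum'[OF f, of s b] by simp
      then obtain z where z: "length (s @ [\<not> b]) \<le> length z"
        "controlled f e (s @ [\<not> b]) (z @ [False])" "controlled f e (s @ [\<not> b]) (z @ [True])"
        using Suc by (force simp: algebra_simps)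
      \<comment> \<open>The sibling starts more than \<open>e\<close> below \<open>f s\<close>, so a
        rise by \<open>e\<close> from there stays below \<open>f s\<close>.\<close>
      have "controlled f e s w" if w: "controlled f e (s @ [\<not> b]) w" for w
        unfolding controlled_def
      proof (intro conjI allI impI)
        have tw: "take (Suc (length s)) w = s @ [\<not> b]" using w by (simp add: controlled_def)
        have "take (length s) (take (Suc (length s)) w) = s" unfolding tw by simp
        then show tw': "take (length s) w = s" by simp
        fix n assume "length s \<le> n"
        then consider "n = length s" | "n \<ge> length (s @ [\<not> b])" by force
        then show "f (take n w) \<le> f s + e"
        proof cases
          case 2
          then have "f (take n w) \<le> f (s @ [\<not> b]) + e" using w by (simp add: controlled_def)
          then show ?thesis using b' e by simp
        qed (use tw' e in simp)
      qed
      with z show ?thesis by (intro exI[of _ z]) auto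
    qed
  qed
  moreover obtain m where "f s < real m * e" using e reals_Archimedean3 by blast
  ultimately show ?thesis by blast
qed

text \<open>Branch twice, the second time below one of the first two branches; each branching may
  use half of \<open>e\<close>.\<close>

lemma three_branches:
  assumes f: "martingale f" and e: "0 < e"
  obtains u v0 v1 where "controlled f e s u" "controlled f e s v0" "controlled f e s v1"
    "length s < length u" "length s < length v0" "length s < length v1"
    "incomparable u v0" "incomparable u v1" "incomparable v0 v1"
proof -
  obtain y where y: "length s \<le> length y" "controlled f (e/2) s (y @ [False])" "controlled f (e/2) s (y @ [True])"
    using branching_below[OF f, of "e/2" s] e by auto
  obtain z where z: "length (y @ [True]) \<le> length z" "controlled f (e/2) (y @ [True]) (z @ [False])"
    "controlled f (e/2) (y @ [True]) (z @ [True])"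
    using branching_below[OF f, of "e/2" "y @ [True]"] e by auto
  have c: "controlled f e s (z @ [b])" for b
    using controlled_trans[OF y(3), of "e/2" "z @ [b]"] z(2,3) e by (cases b) auto
  have "(z @ [b]) ! length y = True" for b
  proof -
    have "take (Suc (length y)) (z @ [b]) = y @ [True]" using z(2,3) by (cases b) (auto simp: controlled_def)
    then show ?thesis by (metis lessI nth_append_length nth_take)
  qed
  then have i: "incomparable (y @ [False]) (z @ [b])" for b
    using z(1) unfolding incomparable_def by (intro exI[of _ "length y"]) (auto simp: nth_append)
  have "incomparable (z @ [False]) (z @ [True])"
    unfolding incomparable_def by (intro exI[of _ "length z"]) auto
  with that[of "y @ [False]" "z @ [False]" "z @ [True]"] show thesis
    using c i y(1) z(1) controlled_mono[OF y(2)] e by simp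
qed

text \<open>In contrast to \<^const>\<open>real_computable_in\<close>, any uniform error bound will do, which makes sums easy.\<close>
definition approximable :: "(nat \<Rightarrow> bool) \<Rightarrow> (nat \<Rightarrow> bool list \<Rightarrow> real) \<Rightarrow> bool" where
  "approximable B F \<longleftrightarrow> (\<exists>a c. computable_in B a \<and>
     (\<forall>d w n. \<bar>F d w * 2 ^ n - real (a (pr d (pr (string_encode w) n)))\<bar> \<le> c))"

lemma nat_int_decode: "nat (int_decode e) = (if even e then e div 2 else 0)"
  by (simp add: int_decode_def sum_decode_def)

lemma approximable_const:
  assumes "real_computable_in B f" "\<And>w. 0 \<le> f w"
  shows "approximable B (\<lambda>_. f)"
proof -
  obtain g where g: "computable_in B g"
    "\<And>w n. \<bar>f w - of_int (int_decode (g (prod_encode (string_encode w, n)))) / 2 ^ n\<bar> \<le> 1 / 2 ^ n"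
    using assms(1) unfolding real_computable_in_def by blast
  \<comment> \<open>Odd codes stand for negative integers; replacing these by 0 does no harm since
    \<open>f\<close> is nonnegative.\<close>
  define a where "a z = (if even (g (pi2 z)) then g (pi2 z) div 2 else 0)" for z
  have "computable_in B a" unfolding a_def by (intro cmp cmp_compose[OF g(1)])
  moreover have "\<bar>f w * 2 ^ n - real (a (pr d (pr (string_encode w) n)))\<bar> \<le> 1" for d w n
  proof -
    define k where "k = int_decode (g (prod_encode (string_encode w, n)))"
    have "real (a (pr d (pr (string_encode w) n))) = real (nat k)"
      by (simp add: a_def k_def nat_int_decode pr_def pi2_def)
    moreover have "\<bar>f w * 2 ^ n - of_int k\<bar> \<le> 1"
    proof -
      have "\<bar>f w - of_int k / 2 ^ n\<bar> * 2 ^ n \<le> 1 / 2 ^ n * 2 ^ n"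
        using g(2)[of w n] unfolding k_def by (intro mult_right_mono) auto
      also have "\<bar>f w - of_int k / 2 ^ n\<bar> * 2 ^ n = \<bar>(f w - of_int k / 2 ^ n) * 2 ^ n\<bar>"
        by (simp add: abs_mult)
      finally show ?thesis by (simp add: left_diff_distrib)
    qed
    moreover have "0 \<le> f w * 2 ^ n" using assms(2) by simp
    ultimately show ?thesis by linarith
  qed
  ultimately show ?thesis unfolding approximable_def by blast
qed

lemma approximable_fix:
  assumes "approximable B F" shows "approximable B (\<lambda>_. F k)"
proof -
  obtain a c where a: "computable_in B a" "\<And>d w n. \<bar>F d w * 2 ^ n - real (a (pr d (pr (string_encode w) n)))\<bar> \<le> c"
    using assms unfolding approximable_def by blast
  have "computable_in B (\<lambda>z. a (pr k (pi2 z)))" by (intro cmp cmp_compose[OF a(1)])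
  then show ?thesis unfolding approximable_def
    by (intro exI[of _ "\<lambda>z. a (pr k (pi2 z))"] exI[of _ c]) (simp add: a(2))
qed

lemma approximable_add:
  assumes "approximable B F" "approximable B G" shows "approximable B (\<lambda>d w. F d w + G d w)"
proof -
  obtain a c where a: "computable_in B a" "\<And>d w n. \<bar>F d w * 2 ^ n - real (a (pr d (pr (string_encode w) n)))\<bar> \<le> c"
    using assms(1) unfolding approximable_def by blast
  obtain a' c' where a': "computable_in B a'" "\<And>d w n. \<bar>G d w * 2 ^ n - real (a' (pr d (pr (string_encode w) n)))\<bar> \<le> c'"
    using assms(2) unfolding approximable_def by blast
  have "computable_in B (\<lambda>z. a z + a' z)" by (intro cmp a a')
  moreover have "\<bar>(F d w + G d w) * 2 ^ n - real (a (pr d (pr (string_encode w) n)) + a' (pr d (pr (string_encode w) n)))\<bar> \<le> c + c'" for d w n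
    using a(2)[of d w n] a'(2)[of d w n] by (simp add: distrib_right)
  ultimately show ?thesis unfolding approximable_def by blast
qed

lemma approximable_scale:
  assumes "approximable B F" shows "approximable B (\<lambda>d w. F d w / 2 ^ d)"
proof -
  obtain a c where a: "computable_in B a" "\<And>d w n. \<bar>F d w * 2 ^ n - real (a (pr d (pr (string_encode w) n)))\<bar> \<le> c"
    using assms unfolding approximable_def by blast
  have "computable_in B (\<lambda>z. a z div 2 ^ pi1 z)" by (intro cmp a)
  \<comment> \<open>Dividing by \<open>2 ^ d\<close> does not increase the error, and rounding down
    costs at most 1.\<close>
  moreover have "\<bar>F d w / 2 ^ d * 2 ^ n - real (a (pr d (pr (string_encode w) n)) div 2 ^ d)\<bar> \<le> c + 1" for d w n
  proof -
    define A where "A = a (pr d (pr (string_encode w) n))"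
    have c: "0 \<le> c" using a(2)[of d w n] by linarith
    have "\<bar>F d w / 2 ^ d * 2 ^ n - real A / 2 ^ d\<bar> = \<bar>F d w * 2 ^ n - real A\<bar> / 2 ^ d"
      by (simp add: diff_divide_distrib[symmetric])
    also have "\<dots> \<le> c / 2 ^ d" using a(2)[of d w n] by (simp add: A_def divide_right_mono)
    also have "\<dots> \<le> c / 1" using c by (intro divide_left_mono) auto
    finally have 1: "\<bar>F d w / 2 ^ d * 2 ^ n - real A / 2 ^ d\<bar> \<le> c" by simp
    have 2: "0 \<le> real A / real (2 ^ d) - real (A div 2 ^ d)" "real A / real (2 ^ d) - real (A div 2 ^ d) \<le> 1"
      using floor_divide_of_nat_eq[where ?'a = real, of A "2 ^ d"] by linarith+
    show ?thesis using 1 2 unfolding A_def[symmetric] by simp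
  qed
  ultimately show ?thesis unfolding approximable_def
    by (intro exI[of _ "\<lambda>z. a z div 2 ^ pi1 z"] exI[of _ "c + 1"]) simp
qed

text \<open>The input \<open>d\<close> is the exponent of the weight of the martingale that was added last.\<close>
definition splits :: "(nat \<Rightarrow> bool) \<Rightarrow> prog \<Rightarrow> nat \<Rightarrow> (bool list \<Rightarrow> real) \<Rightarrow> bool" where
  "splits B p d f \<longleftrightarrow> (\<forall>s. \<exists>u v0 v1.
     computes B p (pr d (string_encode s)) (pr (string_encode u) (pr (string_encode v0) (string_encode v1))) \<and>
     (\<forall>z\<in>{u, v0, v1}. length s < length z \<and> controlled f (1 / 2 ^ length s) s z) \<and>
     incomparable u v0 \<and> incomparable u v1 \<and> incomparable v0 v1)"

text \<open>Real inequalities cannot be decided, so the search compares approximations. Its test is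
  implied by a rise of at most \<open>1 / 2 ^ (length s + e)\<close>, so it succeeds, and implies a
  rise of at most \<open>1 / 2 ^ length s\<close>, so its results are correct.\<close>

lemma splitting_program:
  assumes "approximable B F" "\<And>d. martingale (F d)"
  shows "\<exists>p. \<forall>d. splits B p d (F d)"
proof -
  obtain a c where a: "computable_in B a" "\<And>d w n. \<bar>F d w * 2 ^ n - real (a (pr d (pr (string_encode w) n)))\<bar> \<le> c"
    using assms(1) unfolding approximable_def by blast
  \<comment> \<open>In units of \<open>1 / 2 ^ (length s + e)\<close>, the tolerance
    \<open>K\<close> covers one unit of true rise and the error \<open>2 * c\<close> of comparing
    two approximations. A string that passes the test has a true rise of at most
    \<open>K + 2 * c\<close> units, less than the \<open>2 ^ e\<close> units that are
    allowed.\<close>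
  obtain K :: nat where K: "2 * c + 1 \<le> real K" using real_arch_simple by blast
  obtain e :: nat where e: "real K + 2 * c < 2 ^ e" using real_arch_pow[of 2] by auto
  define good where "good x t \<longleftrightarrow> length (list_decode (pi2 x)) < length (list_decode t) \<and>
    (\<forall>k<length (list_decode (pi2 x)). cnth t k = cnth (pi2 x) k) \<and>
    (\<forall>k<length (list_decode t). cnth t k \<le> 1) \<and>
    (\<forall>n<Suc (length (list_decode t)). length (list_decode (pi2 x)) \<le> n \<longrightarrow>
      a (pr (pi1 x) (pr (list_encode (take n (list_decode t))) (length (list_decode (pi2 x)) + e))) \<le>
      a (pr (pi1 x) (pr (pi2 x) (length (list_decode (pi2 x)) + e))) + K)" for x t
  define inc where "inc u v \<longleftrightarrow> (\<exists>k<length (list_decode u). k < length (list_decode v) \<and> \<not> cnth u k = cnth v k)" for u v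
  define P where "P x z \<longleftrightarrow> good x (pi1 z) \<and> good x (pi1 (pi2 z)) \<and> good x (pi2 (pi2 z)) \<and>
     inc (pi1 z) (pi1 (pi2 z)) \<and> inc (pi1 z) (pi2 (pi2 z)) \<and> inc (pi1 (pi2 z)) (pi2 (pi2 z))" for x z
  have "decidable_in B (\<lambda>z. P (pi1 z) (pi2 z))"
    unfolding P_def good_def inc_def by (intro cmp cmp_compose[OF a(1)])
  then obtain p where p: "\<And>x. \<exists>n. P x n \<Longrightarrow> computes B p x (LEAST n. P x n)"
    using search_program by blast
  have inc_iff: "inc (string_encode u) (string_encode v) \<longleftrightarrow> incomparable u v" for u v
    unfolding inc_def incomparable_def by (auto simp: cnth_string_encode)
  have good_iff: "good (pr d (string_encode s)) (string_encode t) \<longleftrightarrow> length s < length t \<and> take (length s) t = s \<and>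
     (\<forall>n\<le>length t. length s \<le> n \<longrightarrow> a (pr d (pr (string_encode (take n t)) (length s + e))) \<le>
        a (pr d (pr (string_encode s) (length s + e))) + K)" for d s t
  proof (cases "length s < length t")
    case True
    have "(\<forall>k<length s. cnth (string_encode t) k = cnth (string_encode s) k) \<longleftrightarrow> (\<forall>k<length s. t ! k = s ! k)"
      using True by (auto simp: cnth_string_encode)
    also have "\<dots> \<longleftrightarrow> take (length s) t = s"
      using True by (auto simp: list_eq_iff_nth_eq)
    finally show ?thesis
      using True unfolding good_def string_encode_take by (simp add: cnth_string_encode less_Suc_eq_le)
  qed (simp add: good_def)
  have good_string: "\<exists>w. t = string_encode w" if "good x t" for x t
  proof (intro exI)
    have "x = of_bool (x = 1)" if "x \<in> set (list_decode t)" for x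
      using that \<open>good _ t\<close> unfolding good_def in_set_conv_nth by (metis cnth_eq le_0_eq le_SucE of_bool_eq One_nat_def)
    then have "map of_bool (map (\<lambda>x. x = 1) (list_decode t)) = list_decode t"
      unfolding map_map by (intro map_idI) auto
    then show "t = string_encode (map (\<lambda>x. x = 1) (list_decode t))"
      by (metis list_decode_inverse string_encode_def)
  qed
  have good_controlled: "controlled (F d) (1 / 2 ^ length s) s t" if "good (pr d (string_encode s)) (string_encode t)" for d s t
    unfolding controlled_def
  proof (intro conjI allI impI)
    show "take (length s) t = s" using that by (simp add: good_iff)
    fix n assume n: "length s \<le> n"
    define n' where "n' = min n (length t)"
    have n': "take n t = take n' t" "length s \<le> n'" "n' \<le> length t"
      using n that unfolding n'_def good_iff by (auto simp: min_def)
    define m where "m = length s + e"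
    have "real (a (pr d (pr (string_encode (take n' t)) m))) \<le> real (a (pr d (pr (string_encode s) m))) + real K"
      using that n' unfolding good_iff m_def by (metis of_nat_add of_nat_le_iff)
    then have "F d (take n' t) * 2 ^ m \<le> F d s * 2 ^ m + (real K + 2 * c)"
      using a(2)[of d "take n' t" m] a(2)[of d s m] by linarith
    also have "\<dots> \<le> F d s * 2 ^ m + 2 ^ e" using e by simp
    also have "\<dots> = (F d s + 1 / 2 ^ length s) * 2 ^ m" by (simp add: m_def power_add distrib_right)
    finally show "F d (take n t) \<le> F d s + 1 / 2 ^ length s" unfolding n'(1) by simp
  qed
  have controlled_good: "good (pr d (string_encode s)) (string_encode t)"
    if t: "controlled (F d) (1 / 2 ^ (length s + e)) s t" "length s < length t" for d s t
    unfolding good_iff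
  proof (intro conjI allI impI)
    show "take (length s) t = s" using t by (simp add: controlled_def)
    fix n assume n: "length s \<le> n"
    define m where "m = length s + e"
    have "F d (take n t) \<le> F d s + 1 / 2 ^ m" using t n by (simp add: controlled_def m_def)
    then have "F d (take n t) * 2 ^ m \<le> (F d s + 1 / 2 ^ m) * 2 ^ m" by (intro mult_right_mono) auto
    also have "\<dots> = F d s * 2 ^ m + 1" by (simp add: distrib_right)
    finally have "real (a (pr d (pr (string_encode (take n t)) m))) \<le> real (a (pr d (pr (string_encode s) m))) + real K"
      using a(2)[of d "take n t" m] a(2)[of d s m] K by linarith
    then show "a (pr d (pr (string_encode (take n t)) (length s + e))) \<le> a (pr d (pr (string_encode s) (length s + e))) + K"
      unfolding m_def by (metis of_nat_add of_nat_le_iff)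
  qed (rule t)
  have "splits B p d (F d)" for d
    unfolding splits_def
  proof
    fix s
    let ?x = "pr d (string_encode s)"
    have "0 < 1 / (2 :: real) ^ (length s + e)" by simp
    from three_branches[OF assms(2)[of d] this, of s] obtain u v0 v1 where
      "controlled (F d) (1 / 2 ^ (length s + e)) s u" "controlled (F d) (1 / 2 ^ (length s + e)) s v0"
      "controlled (F d) (1 / 2 ^ (length s + e)) s v1"
      "length s < length u" "length s < length v0" "length s < length v1"
      "incomparable u v0" "incomparable u v1" "incomparable v0 v1" .
    then have "P ?x (pr (string_encode u) (pr (string_encode v0) (string_encode v1)))"
      by (simp add: P_def controlled_good inc_iff)
    then have "\<exists>z. P ?x z" by blast
    then have "computes B p ?x (LEAST z. P ?x z)" "P ?x (LEAST z. P ?x z)" by (rule p, rule LeastI_ex)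
    then obtain z where z: "computes B p ?x z" "P ?x z" by blast
    obtain u v0 v1 where uv: "pi1 z = string_encode u" "pi1 (pi2 z) = string_encode v0" "pi2 (pi2 z) = string_encode v1"
      using z(2) good_string unfolding P_def by metis
    then have "z = pr (string_encode u) (pr (string_encode v0) (string_encode v1))" by (metis pi_pr(3))
    with z uv show "\<exists>u v0 v1. computes B p ?x (pr (string_encode u) (pr (string_encode v0) (string_encode v1))) \<and>
     (\<forall>z\<in>{u, v0, v1}. length s < length z \<and> controlled (F d) (1 / 2 ^ length s) s z) \<and>
     incomparable u v0 \<and> incomparable u v1 \<and> incomparable v0 v1"
      unfolding P_def using good_controlled good_iff inc_iff
      by (intro exI[of _ u] exI[of _ v0] exI[of _ v1]) auto
  qed
  then show ?thesis by blast
qed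

section \<open>Enumerating and bounding martingales\<close>

instance prog :: countable
  by countable_datatype

text \<open>A program approximates at most one function to every precision, and there are only
  countably many programs.\<close>

lemma countable_computable_martingales: "countable {f. martingale f \<and> real_computable_in B f}"
proof -
  define approx where "approx p f \<longleftrightarrow> (\<forall>w n. \<exists>y. computes B p (prod_encode (string_encode w, n)) y \<and>
    \<bar>f w - of_int (int_decode y) / 2 ^ n\<bar> \<le> 1 / 2 ^ n)" for p and f :: "bool list \<Rightarrow> real"
  have uniq: "f = g" if "approx p f" "approx p g" for p f g
  proof
    fix w
    have *: "\<bar>f w - g w\<bar> \<le> 2 * (1 / 2) ^ n" for n
    proof -
      obtain y where "computes B p (prod_encode (string_encode w, n)) y" "\<bar>f w - of_int (int_decode y) / 2 ^ n\<bar> \<le> 1 / 2 ^ n"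
        using \<open>approx p f\<close> unfolding approx_def by blast
      moreover obtain z where "computes B p (prod_encode (string_encode w, n)) z" "\<bar>g w - of_int (int_decode z) / 2 ^ n\<bar> \<le> 1 / 2 ^ n"
        using \<open>approx p g\<close> unfolding approx_def by blast
      ultimately have "\<bar>f w - g w\<bar> \<le> 1 / 2 ^ n + 1 / 2 ^ n"
        using computes_deterministic[of B p _ y z] by fastforce
      then show ?thesis by (simp add: power_one_over)
    qed
    have "(\<lambda>n. 2 * (1 / 2) ^ n :: real) \<longlonglongrightarrow> 2 * 0"
      by (intro tendsto_intros LIMSEQ_realpow_zero) auto
    then have "\<bar>f w - g w\<bar> \<le> 2 * 0" by (rule LIMSEQ_le_const) (use * in blast)
    then show "f w = g w" by simp
  qed
  have "\<exists>p. approx p f" if "real_computable_in B f" for f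
    using that unfolding real_computable_in_def computable_in_def approx_def by meson
  then have "{f. martingale f \<and> real_computable_in B f} \<subseteq> range (\<lambda>p. SOME f. approx p f)"
    using uniq by (auto simp: image_iff) (metis someI_ex)
  then show ?thesis by (rule countable_subset) simp
qed

lemma computable_martingales_enumeration:
  obtains f :: "nat \<Rightarrow> bool list \<Rightarrow> real"
  where "range f = {f. martingale f \<and> real_computable_in B f}"
proof -
  have "capital 0 \<in> {f. martingale f \<and> real_computable_in B f}"
    by (simp add: martingale_capital real_computable_capital)
  with countable_computable_martingales[of B] show thesis
    using that uncountable_def by blast
qed

text \<open>A weighted sum of all the martingales is again a martingale. Always taking a bit on
  which it does not increase keeps it bounded, and with it every summand.\<close>

lemma exists_bounding_sequence:
  fixes f :: "nat \<Rightarrow> bool list \<Rightarrow> real"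
  assumes f: "\<And>i. martingale (f i)"
  shows "\<exists>A. \<forall>i. bounded {f i (prefix_of_seq A n) |n. True}"
proof -
  \<comment> \<open>A martingale at most doubles with each bit, so these weights make the series
    converge at every string; the added 1 covers martingales that start at 0.\<close>
  define c where "c i = (1 / 2) ^ i / (1 + f i [])" for i
  have f0: "0 \<le> f i w" for i w by (rule martingale_nonneg[OF f])
  have c: "0 < c i" for i using f0[of i "[]"] by (simp add: c_def)
  have "c i * f i w \<le> 2 ^ length w * (1 / 2) ^ i" for i w
  proof -
    have "c i * f i w \<le> c i * (2 ^ length w * f i [])"
      using martingale_growth[OF f] c[of i] by (intro mult_left_mono) auto
    also have "\<dots> = 2 ^ length w * (1 / 2) ^ i * (f i [] / (1 + f i []))" by (simp add: c_def)
    also have "\<dots> \<le> 2 ^ length w * (1 / 2) ^ i * 1"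
      using f0[of i "[]"] by (intro mult_left_mono) auto
    finally show ?thesis by simp
  qed
  then have le: "norm (c i * f i w) \<le> 2 ^ length w * (1 / 2) ^ i" for i w
    using f0[of i w] c[of i] by simp
  have summable: "summable (\<lambda>i. c i * f i w)" for w
    by (rule summable_comparison_test'[OF _ le]) (intro summable_mult summable_geometric, simp)
  define F where "F w = (\<Sum>i. c i * f i w)" for w
  have F: "martingale F"
  proof (rule martingaleI)
    show "0 \<le> F w" for w unfolding F_def using f0 c by (intro suminf_nonneg summable) (simp add: less_imp_le)
    have "c i * f i (w @ [False]) + c i * f i (w @ [True]) = 2 * (c i * f i w)" for i w
      using martingale_sum[OF f, of i w] by (simp flip: distrib_left)
    then show "F (w @ [False]) + F (w @ [True]) = 2 * F w" for w
      unfolding F_def suminf_add[OF summable summable] by (simp add: suminf_mult[OF summable])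
  qed
  define S where "S = rec_nat [] (\<lambda>_ w. w @ [F (w @ [True]) \<le> F (w @ [False])])"
  define A where "A n = (F (S n @ [True]) \<le> F (S n @ [False]))" for n
  have S: "prefix_of_seq A n = S n" for n
    by (induction n) (simp_all add: S_def A_def prefix_of_seq_def)
  have le: "F (S n) \<le> F []" for n
  proof (induction n)
    case (Suc n)
    have "F (S (Suc n)) \<le> F (S n)"
      using martingale_sum[OF F, of "S n"] by (cases "F (S n @ [True]) \<le> F (S n @ [False])") (auto simp: S_def)
    with Suc show ?case by simp
  qed (simp add: S_def)
  have "norm (f i (prefix_of_seq A n)) \<le> F [] / c i" for i n
  proof -
    have "(\<Sum>j\<in>{i}. c j * f j (S n)) \<le> F (S n)"
      unfolding F_def using f0 c by (intro sum_le_suminf summable) (auto simp: less_imp_le)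
    with le[of n] have "c i * f i (S n) \<le> F []" by simp
    then show ?thesis using c[of i] f0 by (simp add: S pos_le_divide_eq mult.commute)
  qed
  then show ?thesis by (intro exI[of _ A] allI) (auto simp: bounded_iff)
qed

corollary exists_computably_random: "\<exists>A. computably_random A"
proof -
  obtain f :: "nat \<Rightarrow> bool list \<Rightarrow> real" where f: "range f = {f. martingale f \<and> real_computable_in (\<lambda>_. False) f}"
    by (rule computable_martingales_enumeration)
  then have "martingale (f i)" for i by blast
  then obtain A where "bounded {f i (prefix_of_seq A n) |n. True}" for i
    using exists_bounding_sequence[of f] by blast
  moreover have "\<exists>i. g = f i" if "martingale g \<and> real_computable_in (\<lambda>_. False) g" for g
    using that f by blast
  ultimately show ?thesis unfolding computably_random_def computably_random_rel_def by metis
qed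

text \<open>The added term is the sum of \<open>1 / 2 ^ k\<close> over all k from
  \<open>length s\<close> on: a reserve for the rises that later splits may cause.\<close>

definition potential :: "(bool list \<Rightarrow> real) \<Rightarrow> bool list \<Rightarrow> real" where
  "potential f s = f s + 2 / 2 ^ length s"

definition tame :: "(bool list \<Rightarrow> real) \<Rightarrow> bool list \<Rightarrow> bool list \<Rightarrow> bool" where
  "tame f s z \<longleftrightarrow> controlled f (2 / 2 ^ length s) s z \<and> potential f z \<le> potential f s"

lemma tame_self: "tame f s s"
  by (simp add: tame_def controlled_self)

text \<open>The string gets longer, so the reserve at least halves; this releases enough to pay for
  the rise by \<open>1 / 2 ^ length y\<close>.\<close>

lemma tame_split:
  assumes "tame f s y" "controlled f (1 / 2 ^ length y) y z" "length y < length z"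
  shows "tame f s z"
  unfolding tame_def
proof
  have "f z \<le> f y + 1 / 2 ^ length y" by (rule controlled_le[OF assms(2)])
  moreover have "2 / 2 ^ length z \<le> 1 / (2 :: real) ^ length y"
  proof -
    have "2 * 2 ^ length y \<le> (2 :: real) ^ length z"
      using power_increasing[of "Suc (length y)" "length z" "2 :: real"] assms(3) by simp
    then show ?thesis by (simp add: divide_simps)
  qed
  ultimately have "potential f z \<le> potential f y" by (simp add: potential_def)
  then show "potential f z \<le> potential f s" using assms(1) by (simp add: tame_def)
  show "controlled f (2 / 2 ^ length s) s z"
    unfolding controlled_def
  proof (intro conjI allI impI)
    have sy: "length s \<le> length y" using assms(1) by (simp add: tame_def controlled_def take_eq_length_le)
    show "take (length s) z = s"
      using assms(1,2) sy unfolding tame_def controlled_def by (metis min.absorb1 take_take)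
    fix n assume n: "length s \<le> n"
    show "f (take n z) \<le> f s + 2 / 2 ^ length s"
    proof (cases "n \<le> length y")
      case True
      then have "take n z = take n y" using assms(2) unfolding controlled_def by (metis min.absorb1 take_take)
      then show ?thesis using assms(1) n unfolding tame_def controlled_def by simp
    next
      case False
      then have "f (take n z) \<le> f y + 1 / 2 ^ length y" using assms(2) unfolding controlled_def by simp
      also have "\<dots> \<le> potential f y" by (simp add: potential_def divide_right_mono)
      also have "\<dots> \<le> potential f s" using assms(1) by (simp add: tame_def)
      finally show ?thesis by (simp add: potential_def)
    qed
  qed
qed

text \<open>The message is \<open>q\<close> choices of \<open>u\<close> and then one bet. However
  large \<open>q\<close> is, \<open>tame\<close> bounds the rise in terms of \<open>s\<close>
  alone.\<close>

lemma reaches_message: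
  assumes p: "splits A p d f" and R: "reaches A S c (prog_code p) d s 0 t"
  shows "\<exists>z t'. t < t' \<and> length s < length z \<and> tame f s z \<and> reaches A S (2 * c) q (string_encode z) z 0 t'"
proof -
  have split: "\<exists>t'>t. (\<exists>u. length s < length u \<and> controlled f (1 / 2 ^ length s) s u \<and>
        reaches A S c (prog_code p) d u (Suc q) t') \<and>
      (\<exists>z. length s < length z \<and> controlled f (1 / 2 ^ length s) s z \<and>
        reaches A S (2 * c) q (string_encode z) z 0 t')"
    if R: "reaches A S c (prog_code p) d s q t" for s q t
  proof -
    obtain u v0 v1 where
      comp: "computes A p (pr d (string_encode s)) (pr (string_encode u) (pr (string_encode v0) (string_encode v1)))" and
      len: "\<forall>z\<in>{u, v0, v1}. length s < length z \<and> controlled f (1 / 2 ^ length s) s z" and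
      inc: "incomparable u v0" "incomparable u v1" "incomparable v0 v1"
      using p unfolding splits_def by meson
    have "take (length s) u = s" "take (length s) v0 = s" "take (length s) v1 = s"
      using len by (auto simp: controlled_def)
    from reaches_split[OF R comp this inc] obtain t' z where "t < t'" "z \<in> {v0, v1}"
      "reaches A S c (prog_code p) d u (Suc q) t'" "reaches A S (2 * c) q (string_encode z) z 0 t'" by blast
    then show ?thesis using len by (intro exI[of _ t'] conjI exI[of _ u] exI[of _ z]) auto
  qed
  have "\<exists>y t'. t \<le> t' \<and> length s \<le> length y \<and> tame f s y \<and> reaches A S c (prog_code p) d y q t'" for q
  proof (induction q)
    case 0
    then show ?case using R tame_self by blast
  next
    case (Suc q)
    then obtain y t' where y: "t \<le> t'" "length s \<le> length y" "tame f s y" "reaches A S c (prog_code p) d y q t'" by blast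
    from split[OF y(4)] obtain u t'' where u: "t' < t''" "length y < length u" "controlled f (1 / 2 ^ length y) y u"
      "reaches A S c (prog_code p) d u (Suc q) t''" by blast
    show ?case using tame_split[OF y(3) u(3,2)] u y(1,2) by (intro exI[of _ u] exI[of _ t'']) simp
  qed
  then obtain y t' where y: "t \<le> t'" "length s \<le> length y" "tame f s y" "reaches A S c (prog_code p) d y q t'" by blast
  from split[OF y(4)] obtain z t'' where z: "t' < t''" "length y < length z" "controlled f (1 / 2 ^ length y) y z"
    "reaches A S (2 * c) q (string_encode z) z 0 t''" by blast
  show ?thesis using tame_split[OF y(3) z(3,2)] z y(1,2) by (intro exI[of _ z] exI[of _ t'']) simp
qed

section \<open>Construction of the sequence\<close>

lemma martingale_add:
  assumes "martingale f" "martingale g" shows "martingale (\<lambda>w. f w + g w)"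
proof (rule martingaleI)
  show "f (w @ [False]) + g (w @ [False]) + (f (w @ [True]) + g (w @ [True])) = 2 * (f w + g w)" for w
    using martingale_sum[OF assms(1), of w] martingale_sum[OF assms(2), of w] by simp
qed (use assms in \<open>simp add: martingale_nonneg\<close>)

lemma martingale_divide:
  assumes "martingale f" "0 < c" shows "martingale (\<lambda>w. f w / c)"
proof (rule martingaleI)
  show "f (w @ [False]) / c + f (w @ [True]) / c = 2 * (f w / c)" for w
    using martingale_sum[OF assms(1), of w] by (simp flip: add_divide_distrib)
qed (use assms in \<open>simp add: martingale_nonneg\<close>)

lemma exists_relatively_random_with_nonrandom_join:
  "\<exists>B. computably_random_rel A B \<and> \<not> computably_random (join A B)"
proof -
  obtain g :: "nat \<Rightarrow> bool list \<Rightarrow> real" where g: "range g = {f. martingale f \<and> real_computable_in A f}"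
    by (rule computable_martingales_enumeration)
  have gm: "martingale (g i)" and gc: "real_computable_in A (g i)" for i
    using g by blast+
  \<comment> \<open>Normalising by a power of two keeps the martingale approximable.\<close>
  have "\<exists>e. g i [] / 2 ^ e \<le> (1 / 2) ^ i" for i
  proof -
    obtain e where "g i [] * 2 ^ i < 2 ^ e" using real_arch_pow[of 2] by auto
    then show ?thesis by (intro exI[of _ e]) (simp add: divide_simps mult.commute)
  qed
  then obtain e where e: "\<And>i. g i [] / 2 ^ e i \<le> (1 / 2) ^ i" by metis
  define N where "N i w = g i w / 2 ^ e i" for i w
  have N: "martingale (N i)" for i unfolding N_def by (rule martingale_divide[OF gm]) simp
  have N_nonneg: "0 \<le> N i w" for i w by (rule martingale_nonneg[OF N])
  have Na: "approximable A (\<lambda>_. N i)" for i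
    using approximable_fix[OF approximable_scale[OF approximable_const[OF gc martingale_nonneg[OF gm]]], of i "e i"]
    by (simp add: N_def[abs_def])
  have add_program: "\<exists>p. \<forall>d. splits A p d (\<lambda>w. M w + N i w / 2 ^ d)"
    if "martingale M" "approximable A (\<lambda>_. M)" for M i
    by (rule splitting_program)
      (use that in \<open>auto intro!: approximable_add approximable_scale Na martingale_add martingale_divide N\<close>)
  obtain p0 where p0: "splits A p0 d (\<lambda>w. N 0 w / 2 ^ d)" for d
    using splitting_program[OF approximable_scale[OF Na] martingale_divide[OF N]] by auto
  define S where "S = state 1 (prog_code p0) (string_encode []) (string_encode []) 0"
  \<comment> \<open>The weight of \<open>N k\<close> in \<open>M\<close> is only required to be
    positive, which is enough to carry a bound on \<open>M\<close> over to
    \<open>N k\<close>.\<close>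
  define stage where "stage k = (\<lambda>(s, t, M, p). martingale M \<and> approximable A (\<lambda>_. M) \<and>
    (\<exists>d::nat. \<forall>w. N k w / 2 ^ d \<le> M w) \<and> splits A p (string_encode s) M \<and> reaches A S (2 ^ k) (prog_code p) (string_encode s) s 0 t)" for k
  define follows where "follows k = (\<lambda>(s, t :: nat, M, p :: prog) (s', t' :: nat, M', p' :: prog).
    length s < length s' \<and> t < t' \<and> tame M s s' \<and>
    M' = (\<lambda>w. M w + N (Suc k) w / 2 ^ string_encode s'))" for k :: nat
  have "\<exists>X. \<forall>k. stage k (X k) \<and> follows k (X k) (X (Suc k))"
  proof (rule dependent_nat_choice)
    have "martingale (\<lambda>w. N 0 w / 2 ^ string_encode [])" by (intro martingale_divide N) simp
    moreover have "approximable A (\<lambda>_ w. N 0 w / 2 ^ string_encode [])"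
      by (rule approximable_fix[OF approximable_scale[OF Na]])
    moreover have "reaches A S (2 ^ 0) (prog_code p0) (string_encode []) [] 0 0"
      by (simp add: reaches_def S_def prefix_of_seq_def run_Nil)
    ultimately have "stage 0 ([], 0, \<lambda>w. N 0 w / 2 ^ string_encode [], p0)"
      using p0[of "string_encode []"] unfolding stage_def by blast
    then show "\<exists>x. stage 0 x" by blast
  next
    fix x k assume st0: "stage k x"
    obtain s t M p where x: "x = (s, t, M, p)" by (cases x)
    then have M: "martingale M" "approximable A (\<lambda>_. M)" and p: "splits A p (string_encode s) M"
      and R: "reaches A S (2 ^ k) (prog_code p) (string_encode s) s 0 t"
      using st0 by (auto simp: stage_def)
    \<comment> \<open>\<open>p'\<close> is fixed before \<open>s'\<close>, since \<open>s'\<close>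
      spells out its code. It therefore has to work for every \<open>d\<close>, and \<open>d\<close>
      becomes the code of \<open>s'\<close> only afterwards.\<close>
    obtain p' where p': "\<And>d. splits A p' d (\<lambda>w. M w + N (Suc k) w / 2 ^ d)"
      using add_program[OF M, of "Suc k"] by blast
    obtain s' t' where st: "t < t'" "length s < length s'" "tame M s s'"
      "reaches A S (2 * 2 ^ k) (prog_code p') (string_encode s') s' 0 t'"
      using reaches_message[OF p R] by blast
    define M' where "M' w = M w + N (Suc k) w / 2 ^ string_encode s'" for w
    have "martingale M'" unfolding M'_def by (intro martingale_add martingale_divide M N) simp
    moreover have "approximable A (\<lambda>_. M')"
      unfolding M'_def by (rule approximable_fix[OF approximable_add[OF M(2) approximable_scale[OF Na]]])
    moreover have "N (Suc k) w / 2 ^ string_encode s' \<le> M' w" for w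
      using martingale_nonneg[OF M(1)] by (simp add: M'_def)
    moreover have "splits A p' (string_encode s') M'" unfolding M'_def by (rule p')
    ultimately have "stage (Suc k) (s', t', M', p')" using st(4) by (auto simp: stage_def)
    moreover have "follows k x (s', t', M', p')" using st by (auto simp: follows_def x M'_def)
    ultimately show "\<exists>y. stage (Suc k) y \<and> follows k x y" by blast
  qed
  then obtain X where X: "\<And>k. stage k (X k)" "\<And>k. follows k (X k) (X (Suc k))" by blast
  define s t M where "s k = fst (X k)" and "t k = fst (snd (X k))" and "M k = fst (snd (snd (X k)))" for k
  define p where "p k = snd (snd (snd (X k)))" for k
  have Xk: "X k = (s k, t k, M k, p k)" for k by (simp add: s_def t_def M_def p_def)
  have Mk: "martingale (M k)" and R: "reaches A S (2 ^ k) (prog_code (p k)) (string_encode (s k)) (s k) 0 (t k)" for k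
    using X(1)[of k] unfolding Xk stage_def by simp_all
  have len: "length (s k) < length (s (Suc k))" and tame: "tame (M k) (s k) (s (Suc k))"
    and M_Suc: "M (Suc k) w = M k w + N (Suc k) w / 2 ^ string_encode (s (Suc k))" for k w
    using X(2)[of k] unfolding Xk follows_def by simp_all
  have ctrl: "controlled (M k) (2 / 2 ^ length (s k)) (s k) (s (Suc k))" for k
    using tame[of k] by (simp add: tame_def)
  have len_k: "k \<le> length (s k)" for k
    by (induction k) (use len in \<open>auto simp: Suc_le_eq intro: le_less_trans\<close>)
  have mono: "length (s i) \<le> length (s j)" if "i \<le> j" for i j
    using lift_Suc_mono_le[of "\<lambda>k. length (s k)", OF less_imp_le[OF len] that] .
  have pre: "take (length (s i)) (s (i + j)) = s i" for i j
  proof (induction j)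
    case (Suc j)
    have "length (s i) \<le> length (s (i + j))" by (rule mono) simp
    then have "take (length (s i)) (s (i + Suc j)) = take (length (s i)) (take (length (s (i + j))) (s (i + Suc j)))"
      by (simp add: min_def)
    also have "take (length (s (i + j))) (s (i + Suc j)) = s (i + j)" using ctrl[of "i + j"] by (simp add: controlled_def)
    finally show ?case using Suc by simp
  qed simp
  \<comment> \<open>\<open>s (Suc n)\<close> has more than \<open>n\<close> bits.\<close>
  define B where "B n = s (Suc n) ! n" for n
  have B: "B n = s k ! n" if "n < length (s k)" for n k
  proof (cases "k \<le> Suc n")
    case True
    then have "take (length (s k)) (s (Suc n)) = s k" using pre[of k "Suc n - k"] by simp
    then show ?thesis using that unfolding B_def by (metis nth_take)
  next
    case False
    then have "take (length (s (Suc n))) (s k) = s (Suc n)" using pre[of "Suc n" "k - Suc n"] by simp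
    then show ?thesis using len_k[of "Suc n"] unfolding B_def by (metis Suc_le_lessD nth_take)
  qed
  have prefix: "prefix_of_seq B n = take n (s k)" if "n \<le> length (s k)" for n k
    using that by (intro nth_equalityI) (auto simp: B)
  \<comment> \<open>Growth up to \<open>w\<close> is at most by the factor
    \<open>2 ^ length w\<close>, and the code of \<open>w\<close> is at least its length. Thus a
    newcomer costs little at the string where it enters.\<close>
  have N_small: "N (Suc k) w / 2 ^ string_encode w \<le> (1 / 2) ^ Suc k" for k w
  proof -
    have "N (Suc k) w \<le> 2 ^ length w * N (Suc k) []" by (rule martingale_growth[OF N])
    also have "\<dots> \<le> 2 ^ string_encode w * (1 / 2) ^ Suc k"
      using e[of "Suc k"] length_le_string_encode[of w] N_nonneg
      by (intro mult_mono) (auto simp: N_def)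
    finally show ?thesis by (simp add: divide_simps mult.commute)
  qed
  \<comment> \<open>Between stages the potential can grow only through the entry of a new
    martingale, and these costs sum to less than 1.\<close>
  have pot: "potential (M k) (s k) \<le> potential (M 0) (s 0) + (1 - (1 / 2) ^ k)" for k
  proof (induction k)
    case (Suc k)
    have "potential (M (Suc k)) (s (Suc k)) = potential (M k) (s (Suc k)) + N (Suc k) (s (Suc k)) / 2 ^ string_encode (s (Suc k))"
      by (simp add: potential_def M_Suc)
    also have "\<dots> \<le> potential (M k) (s k) + (1 / 2) ^ Suc k"
      using tame[of k] N_small[of k "s (Suc k)"] unfolding tame_def by linarith
    finally show ?case using Suc by simp
  qed simp
  define C where "C = potential (M 0) (s 0) + 1"
  have MC: "M k (prefix_of_seq B n) \<le> C" if "length (s k) \<le> n" "n \<le> length (s (Suc k))" for k n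
  proof -
    have "M k (prefix_of_seq B n) \<le> M k (s k) + 2 / 2 ^ length (s k)"
      using ctrl[of k] that by (simp add: prefix[OF that(2)] controlled_def)
    also have "\<dots> = potential (M k) (s k)" by (simp add: potential_def)
    also have "\<dots> \<le> C" using pot[of k] zero_le_power[of "1 / 2 :: real" k] unfolding C_def by linarith
    finally show ?thesis .
  qed
  have M_mono: "M i w \<le> M (i + j) w" for i j w
  proof (induction j)
    case (Suc j)
    have "M (i + j) w \<le> M (i + Suc j) w" using N_nonneg by (simp add: M_Suc)
    with Suc show ?case by simp
  qed simp
  have bounded_g: "bounded {g i (prefix_of_seq B n) |n. True}" for i
  proof -
    obtain d :: nat where d: "\<And>w. N i w / 2 ^ d \<le> M i w" using X(1)[of i] unfolding Xk stage_def by auto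
    define L where "L = length (s i)"
    have "g i (prefix_of_seq B n) \<le> C * 2 ^ d * 2 ^ e i" if L: "L \<le> n" for n
    proof -
      \<comment> \<open>Position \<open>n\<close> lies in the block from \<open>s k\<close> to
        \<open>s (Suc k)\<close>, where \<open>M k\<close> is under control and dominates
        \<open>M i\<close>.\<close>
      define k where "k = (LEAST k. n < length (s (Suc k)))"
      have ex: "n < length (s (Suc n))" using len_k[of "Suc n"] by simp
      then have k: "n < length (s (Suc k))" unfolding k_def by (rule LeastI)
      have i: "i \<le> k"
        using k L mono[of "Suc k" i] unfolding L_def by linarith
      have k': "length (s k) \<le> n"
      proof (cases k)
        case 0
        then show ?thesis using i L by (simp add: L_def)
      next
        case (Suc j)
        then show ?thesis using not_less_Least[of j "\<lambda>k. n < length (s (Suc k))"] by (simp add: k_def)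
      qed
      have "N i (prefix_of_seq B n) / 2 ^ d \<le> M k (prefix_of_seq B n)"
        using d[of "prefix_of_seq B n"] M_mono[of i "prefix_of_seq B n" "k - i"] i by simp
      also have "\<dots> \<le> C" using MC k k' by simp
      finally show ?thesis by (simp add: N_def divide_simps mult.commute mult.left_commute)
    qed
    \<comment> \<open>The finitely many prefixes shorter than \<open>s i\<close>, where
      \<open>g i\<close> has not yet taken part, form a bounded set.\<close>
    then have "g i (prefix_of_seq B n) \<in> (\<lambda>n. g i (prefix_of_seq B n)) ` {..<L} \<union> {0..C * 2 ^ d * 2 ^ e i}" for n
      using martingale_nonneg[OF gm] by (cases "n < L") auto
    then have "{g i (prefix_of_seq B n) |n. True} \<subseteq> (\<lambda>n. g i (prefix_of_seq B n)) ` {..<L} \<union> {0..C * 2 ^ d * 2 ^ e i}"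
      by blast
    moreover have "bounded ((\<lambda>n. g i (prefix_of_seq B n)) ` {..<L} \<union> {0..C * 2 ^ d * 2 ^ e i})"
      by (simp add: finite_imp_bounded)
    ultimately show ?thesis by (rule bounded_subset[rotated])
  qed
  have "computably_random_rel A B"
    unfolding computably_random_rel_def
  proof (intro allI impI)
    fix f assume "martingale f \<and> real_computable_in A f"
    then have "f \<in> range g" using g by blast
    then show "bounded {f (prefix_of_seq B n) |n. True}" using bounded_g by blast
  qed
  moreover have "\<not> computably_random (join A B)"
  proof
    assume "computably_random (join A B)"
    then have "bounded {capital S (prefix_of_seq (join A B) n) |n. True}"
      unfolding computably_random_def computably_random_rel_def
      using martingale_capital real_computable_capital by blast
    then obtain a where a: "\<And>n. \<bar>capital S (prefix_of_seq (join A B) n)\<bar> \<le> a"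
      unfolding bounded_iff by auto
    obtain k where k: "a < 2 ^ k" using real_arch_pow[of 2 a] by auto
    have "extends B (s k)" unfolding extends_def using B by simp
    then have "capital S (prefix_of_seq (join A B) (2 * t k)) = 2 ^ k"
      using R[of k] unfolding reaches_def capital_def by (simp add: state_def)
    with a[of "2 * t k"] k show False by simp
  qed
  ultimately show ?thesis by blast
qed

theorem theorem1:
  "\<exists>C :: nat \<Rightarrow> bool.
     \<not> computably_random C \<and>
     computably_random (odd_bits C) \<and>
     computably_random_rel (odd_bits C) (even_bits C)"
proof -
  obtain A where A: "computably_random A" using exists_computably_random by blast
  obtain B where "computably_random_rel A B" "\<not> computably_random (join A B)"
    using exists_relatively_random_with_nonrandom_join by blast
  moreover have "odd_bits (join A B) = A" "even_bits (join A B) = B"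
    by (auto simp: odd_bits_def even_bits_def join_def)
  ultimately show ?thesis using A by (intro exI[of _ "join A B"]) simp
qed

end
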